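(* Let $k\in\mathbb{N}$. For every $1\le k'\le k$ there is a constant $C_{k',k}$ depending only on $k',k$ (and there is $n_0$ depending on $k$) such that for all $n\ge n_0$, \[ \left\|\frac{1_{\mathcal{U}_{2n}}}{\mathbb{E}[1_{\mathcal{U}_{2n}}]}-\frac{1_{\mathcal{D}_{2n,k}}}{\mathbb{E}[1_{\mathcal{D}_{2n,k}}]}\right\|_{U_{k'}}^{2^{k'}}\leq\frac{(\log n)^{C_{k',k}}}{n}. \]
   Context: $\mathcal{U}_{2n}=\{x\in\{0,1\}^{2n}:|x|=n\}$, where $|x|$ is the Hamming weight. For $k\in\mathbb{N}$, let $a$ be such that $n\equiv a\pmod{2^{k-1}}$ and $\mathcal{D}_{2n,k}=\{x\in\{0,1\}^{2n}:|x|\equiv a\pmod{2^{k-1}}\}$. Expectations are under the uniform measure on $\{0,1\}^{2n}$. For $s\ge1$ and $F\colon\{0,1\}^m\to\mathbb{C}$, $\|F\|_{U_s}=\big(\mathbb{E}_{x,h_1,\dots,h_s}\prod_{T\subseteq[s]}C^{|T|}F(x\oplus\bigoplus_{i\in T}h_i)\big)^{1/2^s}$, with $x,h_i$ uniform independent in $\{0,1\}^m$, $\oplus$ coordinatewise addition mod 2, and $C$ complex conjugation. *)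

theory Defs
  imports Complex_Main "HOL-Library.FuncSet" "HOL-Library.Indicator_Function"
    "HOL-Library.Z2" "HOL-Number_Theory.Cong"
begin

text \<open>
  The cube \<open>{0,1}\<^sup>m\<close> is modelled by the \<^typ>\<open>bit\<close>-valued sequences vanishing outside the
  coordinates \<open>0, \<dots>, m - 1\<close>.  Since \<^typ>\<open>bit\<close> is the field with two elements, coordinatewise
  addition modulo 2 is pointwise addition, and it preserves the cube.
\<close>

definition cube :: "nat \<Rightarrow> (nat \<Rightarrow> bit) set" where
  "cube m = {x. \<forall>j\<ge>m. x j = 0}"

definition hamming_weight :: "(nat \<Rightarrow> bit) \<Rightarrow> nat" where
  "hamming_weight x = card {j. x j = 1}"

definition uniform_expectation :: "'a set \<Rightarrow> ('a \<Rightarrow> complex) \<Rightarrow> complex" where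
  "uniform_expectation A f = (\<Sum>a\<in>A. f a) / of_nat (card A)"

definition gowers_average :: "nat \<Rightarrow> nat \<Rightarrow> ((nat \<Rightarrow> bit) \<Rightarrow> complex) \<Rightarrow> complex" where
  "gowers_average m s F =
     uniform_expectation (cube m \<times> ({1..s} \<rightarrow>\<^sub>E cube m))
       (\<lambda>(x, h). \<Prod>T\<in>Pow {1..s}. (cnj ^^ card T) (F (\<lambda>j. x j + (\<Sum>i\<in>T. h i j))))"

text \<open>
  For \<open>s \<ge> 1\<close> the average is a nonnegative real number, so that taking the real part loses nothing
  and the root is the ordinary one of a nonnegative real.
\<close>

definition gowers_norm :: "nat \<Rightarrow> nat \<Rightarrow> ((nat \<Rightarrow> bit) \<Rightarrow> complex) \<Rightarrow> real" where
  "gowers_norm m s F = root (2 ^ s) (Re (gowers_average m s F))"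

definition middle_slice :: "nat \<Rightarrow> (nat \<Rightarrow> bit) set" where
  "middle_slice n = {x \<in> cube (2 * n). hamming_weight x = n}"

text \<open>
  The set \<open>\<D>\<^bsub>2n,k\<^esub>\<close>.  It depends on the residue \<open>a\<close> only through its class, which is that of \<open>n\<close>,
  so \<open>n\<close> itself serves as the representative.  Only \<open>k \<ge> 1\<close> is meaningful.
\<close>

definition mod_slice :: "nat \<Rightarrow> nat \<Rightarrow> (nat \<Rightarrow> bit) set" where
  "mod_slice n k = {x \<in> cube (2 * n). [hamming_weight x = n] (mod 2 ^ (k - 1))}"

definition normalized_indicator :: "nat \<Rightarrow> (nat \<Rightarrow> bit) set \<Rightarrow> (nat \<Rightarrow> bit) \<Rightarrow> complex" where
  "normalized_indicator m A x = indicator A x / uniform_expectation (cube m) (indicator A)"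

end

(*
  Put S(x) = 2n - 2|x|, a sum of 2n signs.  Both indicators are functions of S: |x| = n means S = 0,
  and |x| = n mod 2^(k-1) means 2^k | S.  As |S| <= 2n, the former is S = 0 mod 2^k (2n + 1), so the
  difference F expands into the characters exp(i theta S) with theta = 2 pi (j / 2^k + t),
  t = r / (2^k (2n + 1)), |r| <= n, and its coefficients depend on r only.
  The coordinates of a random parallelepiped being independent, the Gowers average becomes a sum over
  families theta = (theta_T), T a subset of [s], of the products of the coefficients times phi(theta)^(2n),
  where phi is the average of cos(sum_T theta_T chi_B(T)) over the Walsh characters chi_B.
  By the orthogonality of the Walsh characters, |phi| is close to 1 only near peaks that lie on
  (2 pi / 2^s) Z, hence on the frequencies 2 pi j / 2^k as s <= k, and near each of them
  phi^(2n) is a copy of phi^(2n) near 0.  There phi agrees with prod_T cos theta_T up to the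
  fourth order, and for that product the sum factors into one-dimensional sums.  These are negligible:
  up to tails, they are what the case s = 0 of the same argument gives for E F = 0.
*)
theory Submission
  imports Defs "HOL-Real_Asymp.Real_Asymp"
begin

declare One_nat_def [simp del]
declare add_bit_eq_xor [simp del]

section \<open>The characteristic function of one coordinate\<close>

definition chi :: "nat set \<Rightarrow> nat set \<Rightarrow> real" where
  "chi B T = (-1) ^ card (B \<inter> T)"

definition walsh_transform :: "nat \<Rightarrow> (nat set \<Rightarrow> real) \<Rightarrow> nat set \<Rightarrow> real" where
  "walsh_transform s \<theta> B = (\<Sum>T\<in>Pow {1..s}. \<theta> T * chi B T)"

text \<open>At one coordinate, the corner \<open>T\<close> of a parallelepiped carries the sign of
  the base point times \<open>chi B T\<close>, where \<open>B\<close> collects the directions whose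
  bit is 1. Averaging over the base sign turns the exponential into a cosine, and the average over
  \<open>B\<close> remains.\<close>

definition step_charfun :: "nat \<Rightarrow> (nat set \<Rightarrow> real) \<Rightarrow> real" where
  "step_charfun s \<theta> = (\<Sum>B\<in>Pow {1..s}. cos (walsh_transform s \<theta> B)) / 2 ^ s"

lemma abs_chi [simp]: "\<bar>chi B T\<bar> = 1"
  by (simp add: chi_def power_abs)

lemma chi_Ints: "chi B T \<in> \<int>"
  by (simp add: chi_def)

lemma chi_commute: "chi B T = chi T B"
  by (simp add: chi_def Int_commute)

text \<open>Summing over \<open>B\<close> means choosing for each \<open>i\<close> whether it
  belongs to \<open>B\<close>, so the sum factors over \<open>i\<close>; an \<open>i\<close> in
  exactly one of \<open>T\<close> and \<open>T'\<close> gives the factor 0.\<close>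

lemma chi_orthogonal:
  assumes "T \<subseteq> {1..s}" "T' \<subseteq> {1..s}"
  shows "(\<Sum>B\<in>Pow {1..s}. chi B T * chi B T') = (if T = T' then 2 ^ s else 0)"
proof -
  define c :: "nat set \<Rightarrow> nat \<Rightarrow> real" where "c T i = (if i \<in> T then -1 else 1)" for T i
  have chi_prod: "chi B T = (\<Prod>i\<in>B. c T i)" if "B \<subseteq> {1..s}" for B T
  proof -
    have "finite B" using that finite_subset by blast
    then show ?thesis
      by (simp add: chi_def c_def prod.If_cases)
  qed
  have "(\<Sum>B\<in>Pow {1..s}. chi B T * chi B T') = (\<Sum>B\<in>Pow {1..s}. (\<Prod>i\<in>B. c T i * c T' i) * (\<Prod>i\<in>{1..s}-B. 1))"
    by (intro sum.cong) (auto simp: chi_prod prod.distrib)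
  also have "\<dots> = (\<Prod>i\<in>{1..s}. c T i * c T' i + 1)"
    by (rule prod_add [symmetric]) simp
  also have "\<dots> = (if T = T' then 2 ^ s else 0)"
  proof (cases "T = T'")
    case True
    then have "(\<Prod>i\<in>{1..s}. c T i * c T' i + 1) = (\<Prod>i\<in>{1..s}. 2)"
      by (intro prod.cong) (auto simp: c_def)
    with True show ?thesis by simp
  next
    case False
    then obtain i where "i \<in> T \<and> i \<notin> T' \<or> i \<notin> T \<and> i \<in> T'" by blast
    then have "i \<in> {1..s}" "c T i * c T' i + 1 = 0"
      using assms by (auto simp: c_def)
    with False show ?thesis
      by (auto intro: prod_zero)
  qed
  finally show ?thesis .
qed

lemma walsh_transform_add: "walsh_transform s (\<lambda>T. \<theta> T + \<psi> T) B = walsh_transform s \<theta> B + walsh_transform s \<psi> B"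
  by (simp add: walsh_transform_def distrib_right sum.distrib)

lemma walsh_transform_inversion:
  assumes "T \<subseteq> {1..s}"
  shows "(\<Sum>B\<in>Pow {1..s}. chi B T * walsh_transform s \<theta> B) = 2 ^ s * \<theta> T"
proof -
  have "(\<Sum>B\<in>Pow {1..s}. chi B T * walsh_transform s \<theta> B)
      = (\<Sum>B\<in>Pow {1..s}. \<Sum>T'\<in>Pow {1..s}. \<theta> T' * (chi B T * chi B T'))"
    by (simp add: walsh_transform_def sum_distrib_left mult_ac)
  also have "\<dots> = (\<Sum>T'\<in>Pow {1..s}. \<theta> T' * (\<Sum>B\<in>Pow {1..s}. chi B T * chi B T'))"
    by (subst sum.swap) (simp add: sum_distrib_left)
  also have "\<dots> = (\<Sum>T'\<in>Pow {1..s}. if T = T' then \<theta> T' * 2 ^ s else 0)"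
    using assms by (intro sum.cong refl) (simp add: chi_orthogonal)
  also have "\<dots> = 2 ^ s * \<theta> T"
    using assms by (simp add: sum.delta)
  finally show ?thesis .
qed

text \<open>Serves the second-order terms: it makes the quadratic part of
  \<open>step_charfun\<close> a plain sum of the squares of the \<open>\<theta> T\<close>, as for a
  product of cosines.\<close>

lemma walsh_transform_parseval:
  "(\<Sum>B\<in>Pow {1..s}. (walsh_transform s \<theta> B)\<^sup>2) = 2 ^ s * (\<Sum>T\<in>Pow {1..s}. (\<theta> T)\<^sup>2)"
proof -
  have "(\<Sum>B\<in>Pow {1..s}. (walsh_transform s \<theta> B)\<^sup>2)
      = (\<Sum>B\<in>Pow {1..s}. \<Sum>T\<in>Pow {1..s}. \<theta> T * (chi B T * walsh_transform s \<theta> B))"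
  proof (intro sum.cong refl)
    fix B
    have "(\<Sum>T\<in>Pow {1..s}. \<theta> T * (chi B T * walsh_transform s \<theta> B)) = walsh_transform s \<theta> B * walsh_transform s \<theta> B"
      by (subst (2) walsh_transform_def) (simp only: sum_distrib_right mult.assoc)
    then show "(walsh_transform s \<theta> B)\<^sup>2 = (\<Sum>T\<in>Pow {1..s}. \<theta> T * (chi B T * walsh_transform s \<theta> B))"
      by (simp add: power2_eq_square)
  qed
  also have "\<dots> = (\<Sum>T\<in>Pow {1..s}. \<theta> T * (\<Sum>B\<in>Pow {1..s}. chi B T * walsh_transform s \<theta> B))"
    by (subst sum.swap) (simp add: sum_distrib_left)
  also have "\<dots> = (\<Sum>T\<in>Pow {1..s}. \<theta> T * (2 ^ s * \<theta> T))"
    by (intro sum.cong refl) (simp add: walsh_transform_inversion)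
  finally show ?thesis
    by (simp add: sum_distrib_left power2_eq_square mult_ac)
qed

lemma abs_walsh_transform_le:
  assumes "\<And>T. T \<subseteq> {1..s} \<Longrightarrow> \<bar>\<theta> T\<bar> \<le> \<delta>"
  shows "\<bar>walsh_transform s \<theta> B\<bar> \<le> 2 ^ s * \<delta>"
proof -
  have "\<bar>walsh_transform s \<theta> B\<bar> \<le> (\<Sum>T\<in>Pow {1..s}. \<bar>\<theta> T * chi B T\<bar>)"
    unfolding walsh_transform_def by (rule sum_abs)
  also have "\<dots> \<le> (\<Sum>T\<in>Pow {1..s}. \<delta>)"
    using assms by (intro sum_mono) (auto simp: abs_mult)
  finally show ?thesis by (simp add: card_Pow)
qed

lemma abs_step_charfun_le: "\<bar>step_charfun s \<theta>\<bar> \<le> 1"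
proof -
  have "\<bar>\<Sum>B\<in>Pow {1..s}. cos (walsh_transform s \<theta> B)\<bar> \<le> (\<Sum>B\<in>Pow {1..s}. 1)"
    by (intro order.trans [OF sum_abs] sum_mono) simp
  then show ?thesis
    by (simp add: step_charfun_def card_Pow)
qed

section \<open>Location of the peaks of the characteristic function\<close>

lemma cos_gt_imp_near_period:
  assumes "cos x > cos \<delta>" "0 \<le> \<delta>" "\<delta> \<le> pi"
  shows "\<exists>m::int. \<bar>x - 2 * pi * m\<bar> < \<delta>"
proof -
  \<comment> \<open>Subtracting the nearest multiple of 2 pi brings \<open>x\<close> into [-pi, pi],
    where the cosine decreases with the absolute value.\<close>
  define m where "m = round (x / (2 * pi))"
  define y where "y = x - 2 * pi * m"
  have "\<bar>of_int m - x / (2 * pi)\<bar> \<le> 1 / 2"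
    unfolding m_def by (rule of_int_round_abs_le)
  then have "2 * pi * \<bar>of_int m - x / (2 * pi)\<bar> \<le> pi"
    by (simp add: field_simps)
  moreover have "\<bar>y\<bar> = 2 * pi * \<bar>of_int m - x / (2 * pi)\<bar>"
  proof -
    have "y = - (2 * pi * (of_int m - x / (2 * pi)))"
      by (simp add: y_def field_simps)
    then show ?thesis by (simp add: abs_mult)
  qed
  ultimately have y: "\<bar>y\<bar> \<le> pi" by simp
  have "cos \<bar>y\<bar> = cos (x + 2 * pi * of_int (- m))"
    by (simp add: y_def)
  also have "\<dots> = cos x"
    by (simp only: cos_add cos_int_2pin sin_int_2pin mult_zero_right mult_1_right diff_zero)
  finally have "cos \<bar>y\<bar> > cos \<delta>" using assms(1) by linarith
  then have "\<bar>y\<bar> < \<delta>"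
    using cos_monotone_0_pi_le[of \<delta> "\<bar>y\<bar>"] assms(2) y by linarith
  then show ?thesis by (auto simp: y_def)
qed

text \<open>When an average of 2^s cosines is within (1 - cos \<delta>) / 2^s of 1 or -1, the
  deficits of the single cosines are nonnegative and add up to less than 1 - cos \<delta>. Hence
  every one of them is close to the extreme value.\<close>

lemma step_charfun_large_imp:
  assumes "\<bar>step_charfun s \<theta>\<bar> > 1 - (1 - cos \<delta>) / 2 ^ s" "0 \<le> \<delta>" "\<delta> \<le> pi"
  obtains p :: int and m :: "nat set \<Rightarrow> int"
  where "\<And>B. B \<subseteq> {1..s} \<Longrightarrow> \<bar>walsh_transform s \<theta> B - (pi * p + 2 * pi * m B)\<bar> < \<delta>"
proof -
  \<comment> \<open>The sign of the average is stored as a parity: translating by pi * p multiplies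
    the cosine by \<sigma>, which reduces both signs to values near 1.\<close>
  define p :: int where "p = (if step_charfun s \<theta> \<ge> 0 then 0 else 1)"
  define \<sigma> :: real where "\<sigma> = cos (pi * p)"
  have \<sigma>: "\<sigma> * step_charfun s \<theta> = \<bar>step_charfun s \<theta>\<bar>" "\<bar>\<sigma>\<bar> = 1"
    by (auto simp: \<sigma>_def p_def)
  have shift: "cos (x - pi * p) = \<sigma> * cos x" for x
    by (auto simp: \<sigma>_def p_def cos_diff)
  have "\<exists>m::int. \<bar>(walsh_transform s \<theta> B - pi * p) - 2 * pi * m\<bar> < \<delta>" if B: "B \<subseteq> {1..s}" for B
  proof (rule cos_gt_imp_near_period)
    have nonneg: "1 - \<sigma> * cos (walsh_transform s \<theta> B') \<ge> 0" for B'
    proof -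
      have "\<bar>\<sigma> * cos (walsh_transform s \<theta> B')\<bar> \<le> 1" using \<sigma> by (simp add: abs_mult)
      then show ?thesis by linarith
    qed
    have "1 - \<sigma> * cos (walsh_transform s \<theta> B) \<le> (\<Sum>B'\<in>Pow {1..s}. 1 - \<sigma> * cos (walsh_transform s \<theta> B'))"
      using B nonneg by (intro member_le_sum) auto
    also have "\<dots> = 2 ^ s * (1 - \<sigma> * step_charfun s \<theta>)"
      by (simp add: sum_subtractf card_Pow step_charfun_def right_diff_distrib flip: sum_distrib_left)
    also have "\<dots> < 2 ^ s * ((1 - cos \<delta>) / 2 ^ s)"
      using assms \<sigma> by (intro mult_strict_left_mono) auto
    also have "\<dots> = 1 - cos \<delta>" by simp
    finally show "cos (walsh_transform s \<theta> B - pi * p) > cos \<delta>"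
      by (simp add: shift)
  qed (use assms in auto)
  then obtain m where "\<And>B. B \<subseteq> {1..s} \<Longrightarrow> \<bar>(walsh_transform s \<theta> B - pi * p) - 2 * pi * of_int (m B)\<bar> < \<delta>"
    by metis
  then show ?thesis
    by (intro that[of p m]) (auto simp: algebra_simps)
qed

lemma step_charfun_cong: "(\<And>T. T \<subseteq> {1..s} \<Longrightarrow> \<theta> T = \<psi> T) \<Longrightarrow> step_charfun s \<theta> = step_charfun s \<psi>"
  by (auto simp: step_charfun_def walsh_transform_def intro!: sum.cong arg_cong[where f = cos])

text \<open>
  Large \<^term>\<open>\<bar>step_charfun s \<theta>\<bar>\<close> puts all the values of
  \<^term>\<open>walsh_transform s \<theta>\<close> near \<open>\<pi>p + 2\<pi>\<int>\<close>, with one parity \<open>p\<close>.  Inverting the transform divides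
  by \<open>2\<^sup>s\<close>, and since \<open>s \<le> k\<close> the centre lies on \<open>(2\<pi>/2\<^sup>k)\<int>\<close>; the parity only moves the
  coordinate \<open>T = {}\<close>, and by a multiple of \<open>\<pi>\<close>.
\<close>

lemma step_charfun_peak:
  fixes a :: "nat set \<Rightarrow> int"
  assumes "1 \<le> k" "s \<le> k" "0 \<le> \<delta>" "\<delta> < pi / 2 ^ k"
    and t: "\<And>T. T \<subseteq> {1..s} \<Longrightarrow> \<bar>t T\<bar> < pi / 2 ^ k"
    and large: "\<bar>step_charfun s (\<lambda>T. 2 * pi * a T / 2 ^ k + t T)\<bar> > 1 - (1 - cos \<delta>) / 2 ^ s"
  shows "(\<forall>T. T \<subseteq> {1..s} \<longrightarrow> \<bar>t T\<bar> \<le> \<delta>)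
    \<and> (\<exists>\<sigma>. \<bar>\<sigma>\<bar> = 1 \<and> (\<forall>u. step_charfun s (\<lambda>T. 2 * pi * a T / 2 ^ k + u T) = \<sigma> * step_charfun s u))"
proof -
  define d where "d T = 2 * pi * a T / 2 ^ k" for T
  have "(1::real) \<le> 2 ^ k" by simp
  then have "pi / 2 ^ k \<le> pi" by (simp add: divide_le_eq)
  with assms have "\<delta> \<le> pi" by linarith
  have big: "\<bar>step_charfun s (\<lambda>T. d T + t T)\<bar> > 1 - (1 - cos \<delta>) / 2 ^ s"
    using large by (simp add: d_def)
  obtain p :: int and m :: "nat set \<Rightarrow> int"
    where near: "\<And>B. B \<subseteq> {1..s} \<Longrightarrow>
      \<bar>walsh_transform s (\<lambda>T. d T + t T) B - (pi * p + 2 * pi * m B)\<bar> < \<delta>"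
    by (rule step_charfun_large_imp[OF big \<open>0 \<le> \<delta>\<close> \<open>\<delta> \<le> pi\<close>]) blast
  define L where "L B = pi * p + 2 * pi * m B" for B
  \<comment> \<open>\<open>L\<close> is the exact lattice value close to the transform, and
    \<open>d'\<close> is its inverse Walsh transform; the aim is \<open>d' = d\<close>.\<close>
  define d' where "d' T = (\<Sum>B\<in>Pow {1..s}. chi B T * L B) / 2 ^ s" for T
  have walsh_transform_d': "walsh_transform s d' B = L B" if "B \<subseteq> {1..s}" for B
  proof -
    have "walsh_transform s d' B = (\<Sum>T\<in>Pow {1..s}. chi T B * walsh_transform s L T) / 2 ^ s"
    proof -
      have "(\<Sum>B\<in>Pow {1..s}. chi B T * L B) = walsh_transform s L T" for T
        unfolding walsh_transform_def by (intro sum.cong refl) (metis chi_commute mult.commute)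
      then have "d' T * chi B T = chi T B * walsh_transform s L T / 2 ^ s" for T
        by (simp add: d'_def chi_commute[of T B])
      then show ?thesis by (simp add: walsh_transform_def[of s d'] sum_divide_distrib)
    qed
    then show ?thesis
      using walsh_transform_inversion[OF that] by simp
  qed
  \<comment> \<open>Inversion averages 2^s errors, each below \<delta>, up to signs, so no factor is
    lost.\<close>
  have close: "\<bar>d T + t T - d' T\<bar> \<le> \<delta>" if T: "T \<subseteq> {1..s}" for T
  proof -
    have "2 ^ s * (d T + t T - d' T)
        = (\<Sum>B\<in>Pow {1..s}. chi B T * (walsh_transform s (\<lambda>T. d T + t T) B - L B))"
      using walsh_transform_inversion[OF T, of "\<lambda>T. d T + t T"]
      by (simp add: d'_def algebra_simps sum_subtractf)
    then have "2 ^ s * \<bar>d T + t T - d' T\<bar>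
        = \<bar>\<Sum>B\<in>Pow {1..s}. chi B T * (walsh_transform s (\<lambda>T. d T + t T) B - L B)\<bar>"
      by (metis abs_mult abs_numeral power_abs)
    also have "\<dots> \<le> (\<Sum>B\<in>Pow {1..s}. \<bar>chi B T * (walsh_transform s (\<lambda>T. d T + t T) B - L B)\<bar>)"
      by (rule sum_abs)
    also have "\<dots> \<le> (\<Sum>B\<in>Pow {1..s}. \<delta>)"
      using near by (intro sum_mono) (auto simp: abs_mult L_def less_imp_le)
    finally show ?thesis by (simp add: card_Pow)
  qed
  \<comment> \<open>Both values are multiples of 2 pi / 2^k, and they differ by less than \<delta> +
    pi / 2^k < 2 pi / 2^k.\<close>
  have eq: "d' T = d T" if T: "T \<subseteq> {1..s}" for T
  proof -
    have "(\<Sum>B\<in>Pow {1..s}. chi B T) = (\<Sum>B\<in>Pow {1..s}. chi B T * chi B {})"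
      by (simp add: chi_def)
    also have "\<dots> = (if T = {} then 2 ^ s else 0)"
      using T by (subst chi_orthogonal) auto
    finally have sum_chi: "(\<Sum>B\<in>Pow {1..s}. chi B T) = (if T = {} then 2 ^ s else 0)" .
    obtain c where c: "(\<Sum>B\<in>Pow {1..s}. chi B T * m B) = of_int c"
      using Ints_sum[of "Pow {1..s}" "\<lambda>B. chi B T * m B"] chi_Ints
      by (metis Ints_cases Ints_mult Ints_of_int)
    have "d' T = (pi * p * (\<Sum>B\<in>Pow {1..s}. chi B T) + 2 * pi * (\<Sum>B\<in>Pow {1..s}. chi B T * m B)) / 2 ^ s"
      by (simp add: d'_def L_def algebra_simps sum.distrib sum_distrib_left)
    also have "\<dots> = pi * p * (if T = {} then 1 else 0) + 2 * pi * c / 2 ^ s"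
      by (simp add: sum_chi c add_divide_distrib)
    \<comment> \<open>The common denominator 2^k uses 1 \<le> k for the parity term, a multiple of
      pi, and s \<le> k for the term over 2^s.\<close>
    also have "\<dots> = 2 * pi * of_int ((if T = {} then p * 2 ^ (k - 1) else 0) + c * 2 ^ (k - s)) / 2 ^ k"
    proof -
      have "(2::real) ^ k = 2 * 2 ^ (k - 1)" "(2::real) ^ k = 2 ^ s * 2 ^ (k - s)"
        using assms by (simp_all flip: power_Suc power_add)
      then have "p = 2 * (p * 2 ^ (k - 1)) / (2::real) ^ k" "c / (2::real) ^ s = c * 2 ^ (k - s) / 2 ^ k"
        by (simp_all add: field_simps)
      then show ?thesis
        by (auto simp: field_simps)
    qed
    finally obtain e :: int where e: "d' T = 2 * pi * e / 2 ^ k" by blast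
    have "2 * pi / 2 ^ k * \<bar>of_int (a T - e)\<bar> = \<bar>d T - d' T\<bar>"
      by (simp add: e d_def abs_mult flip: diff_divide_distrib right_diff_distrib)
    also have "\<dots> < 2 * pi / 2 ^ k * 1"
      using close[OF T] t[OF T] assms by linarith
    finally have "\<bar>of_int (a T - e) :: real\<bar> < 1"
      by (subst (asm) mult_less_cancel_left_pos) auto
    then have "a T = e" by linarith
    then show ?thesis by (simp add: e d_def)
  qed
  have "\<bar>t T\<bar> \<le> \<delta>" if "T \<subseteq> {1..s}" for T
    using close[OF that] eq[OF that] by simp
  \<comment> \<open>The transform of \<open>d\<close> is exactly pi * p plus multiples of 2 pi, so
    translating by \<open>d\<close> multiplies every cosine by the same sign cos (pi * p).\<close>
  moreover have "step_charfun s (\<lambda>T. d T + u T) = cos (pi * p) * step_charfun s u" for u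
  proof -
    have "walsh_transform s d B = L B" if "B \<subseteq> {1..s}" for B
      using walsh_transform_d'[OF that] eq by (simp add: walsh_transform_def)
    moreover have "cos (L B + x) = cos (pi * p) * cos x" for B x
      using sin_npi_int[of p] cos_int_2pin[of "m B"] sin_int_2pin[of "m B"]
      by (simp add: L_def cos_add sin_add mult_ac)
    ultimately show ?thesis
      by (simp add: step_charfun_def walsh_transform_add sum_distrib_left)
  qed
  moreover have "\<bar>cos (pi * p)\<bar> = 1"
    using cos_npi_int[of p] by auto
  ultimately show ?thesis
    unfolding d_def by blast
qed

section \<open>Fourth-order comparison with a product of cosines\<close>

lemma cos_taylor2: "\<bar>cos x - (1 - x\<^sup>2 / 2)\<bar> \<le> x ^ 4 / (24::real)"
proof -
  obtain t where "cos x = (\<Sum>m<4. cos_coeff m * x ^ m) + (cos(t + 1/2 * real 4 * pi) / fact 4) * x ^ 4"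
    using Maclaurin_cos_expansion[of x 4] by blast
  moreover have "(\<Sum>m<4. cos_coeff m * x ^ m) = 1 - x\<^sup>2 / 2" 
    by (simp add: cos_coeff_def lessThan_nat_numeral)
  moreover have "(fact 4::real) = 24" by (simp add: fact_numeral)
  ultimately have "cos x - (1 - x\<^sup>2 / 2) = cos(t + 1/2 * real 4 * pi) * (x ^ 4 / 24)"
    by simp
  then have "\<bar>cos x - (1 - x\<^sup>2 / 2)\<bar> = \<bar>cos(t + 1/2 * real 4 * pi)\<bar> * (x ^ 4 / 24)"
    by (simp only: abs_mult) simp
  also have "\<dots> \<le> 1 * (x ^ 4 / 24)"
    by (intro mult_right_mono) auto
  finally show ?thesis by simp
qed

text \<open>One more factor adds its own Taylor error, at most \<delta>^4, and a cross term
  \<open>a * b\<close>, at most card A * \<delta>^4; both fit into the increase from (card A)^2 to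
  (card A + 1)^2.\<close>

lemma prod_cos_taylor:
  fixes t :: "'a \<Rightarrow> real" and \<delta> :: real
  assumes "finite A" "0 \<le> \<delta>" "\<delta> \<le> 1" "\<And>T. T \<in> A \<Longrightarrow> \<bar>t T\<bar> \<le> (\<delta>::real)"
  shows "\<bar>(\<Prod>T\<in>A. cos (t T)) - (1 - (\<Sum>T\<in>A. (t T)\<^sup>2) / 2)\<bar> \<le> (card A)\<^sup>2 * \<delta> ^ 4"
  using assms(1,4)
proof (induction A rule: finite_induct)
  case (insert S A)
  define P where "P = (\<Prod>T\<in>A. cos (t T))"
  define b where "b = (\<Sum>T\<in>A. (t T)\<^sup>2) / 2"
  define a where "a = (t S)\<^sup>2 / 2"
  define c where "c = cos (t S)"
  have sq: "(t T)\<^sup>2 \<le> \<delta>\<^sup>2" if "T \<in> insert S A" for T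
    using power_mono[OF insert.prems[OF that], of 2] by simp
  have "\<delta>\<^sup>2 \<le> 1" using assms by (simp add: power_le_one)
  have "2 * a \<le> \<delta>\<^sup>2" "0 \<le> a"
    using sq[of S] by (simp_all add: a_def)
  then have a: "0 \<le> a" "a \<le> \<delta>\<^sup>2" "a \<le> 1"
    using \<open>\<delta>\<^sup>2 \<le> 1\<close> by linarith+
  have "2 * b \<le> (\<Sum>T\<in>A. \<delta>\<^sup>2)"
    unfolding b_def using sq by (simp, intro sum_bounded_above) auto
  moreover have "0 \<le> b" by (simp add: b_def sum_nonneg)
  ultimately have b: "0 \<le> b" "b \<le> card A * \<delta>\<^sup>2" by auto
  have "\<bar>P\<bar> \<le> 1"
    unfolding P_def abs_prod by (intro prod_le_1) auto
  have ec: "\<bar>c - (1 - a)\<bar> \<le> \<delta> ^ 4"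
  proof -
    have "\<bar>c - (1 - a)\<bar> \<le> t S ^ 4 / 24"
      using cos_taylor2[of "t S"] by (simp add: c_def a_def)
    also have "\<dots> \<le> \<bar>t S\<bar> ^ 4" by (simp add: power_even_abs)
    also have "\<dots> \<le> \<delta> ^ 4"
      using insert.prems[of S] by (intro power_mono) auto
    finally show ?thesis .
  qed
  have eP: "\<bar>P - (1 - b)\<bar> \<le> (card A)\<^sup>2 * \<delta> ^ 4"
    using insert by (simp add: P_def b_def)
  have ab: "\<bar>a * b\<bar> \<le> card A * \<delta> ^ 4"
  proof -
    have "a * b \<le> \<delta>\<^sup>2 * (card A * \<delta>\<^sup>2)"
      using a b by (intro mult_mono) auto
    also have "\<dots> = card A * \<delta> ^ 4" by (simp flip: power_add)
    finally show ?thesis using a b by simp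
  qed
  have "c * P - (1 - (a + b)) = (c - (1 - a)) * P + (1 - a) * (P - (1 - b)) + a * b"
    by (simp add: algebra_simps)
  also have "\<bar>\<dots>\<bar> \<le> \<bar>(c - (1 - a)) * P\<bar> + \<bar>(1 - a) * (P - (1 - b))\<bar> + \<bar>a * b\<bar>"
    by linarith
  also have "\<bar>(c - (1 - a)) * P\<bar> \<le> \<delta> ^ 4 * 1"
    unfolding abs_mult using ec \<open>\<bar>P\<bar> \<le> 1\<close> by (intro mult_mono) auto
  also have "\<bar>(1 - a) * (P - (1 - b))\<bar> \<le> 1 * ((card A)\<^sup>2 * \<delta> ^ 4)"
    unfolding abs_mult using eP a by (intro mult_mono) auto
  also note ab
  also have "\<delta> ^ 4 * 1 + 1 * ((card A)\<^sup>2 * \<delta> ^ 4) + card A * \<delta> ^ 4 \<le> (card (insert S A))\<^sup>2 * \<delta> ^ 4"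
    using insert.hyps assms(2) by (simp add: power2_eq_square algebra_simps)
  finally show ?case
    using insert.hyps by (simp add: P_def a_def b_def c_def add_divide_distrib)
qed simp

text \<open>Both functions agree with the same quadratic polynomial \<open>q\<close> up to fourth
  order, \<open>step_charfun\<close> by Parseval. The factor 16^s is (2^s)^4, since the transform of
  a family bounded by \<delta> is bounded by 2^s * \<delta>.\<close>

lemma step_charfun_near:
  fixes \<delta> :: real
  assumes "0 \<le> \<delta>" "\<delta> \<le> 1" "\<And>T. T \<subseteq> {1..s} \<Longrightarrow> \<bar>t T\<bar> \<le> \<delta>"
  shows "\<bar>step_charfun s t - (\<Prod>T\<in>Pow {1..s}. cos (t T))\<bar> \<le> 2 * 16 ^ s * \<delta> ^ 4"
proof -
  let ?P = "Pow {1..s}"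
  define q where "q = 1 - (\<Sum>T\<in>?P. (t T)\<^sup>2) / 2"
  have "(\<Sum>B\<in>?P. cos (walsh_transform s t B) - (1 - (walsh_transform s t B)\<^sup>2 / 2)) = 2 ^ s * (step_charfun s t - q)"
    by (simp add: sum_subtractf walsh_transform_parseval step_charfun_def card_Pow q_def right_diff_distrib flip: sum_divide_distrib)
  then have "2 ^ s * \<bar>step_charfun s t - q\<bar> = \<bar>\<Sum>B\<in>?P. cos (walsh_transform s t B) - (1 - (walsh_transform s t B)\<^sup>2 / 2)\<bar>"
    by (metis abs_mult abs_numeral power_abs)
  also have "\<dots> \<le> (\<Sum>B\<in>?P. \<bar>cos (walsh_transform s t B) - (1 - (walsh_transform s t B)\<^sup>2 / 2)\<bar>)"
    by (rule sum_abs)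
  also have "\<dots> \<le> (\<Sum>B\<in>?P. 16 ^ s * \<delta> ^ 4)"
  proof (intro sum_mono)
    fix B
    have "\<bar>cos (walsh_transform s t B) - (1 - (walsh_transform s t B)\<^sup>2 / 2)\<bar> \<le> walsh_transform s t B ^ 4 / 24"
      by (rule cos_taylor2)
    also have "\<dots> \<le> \<bar>walsh_transform s t B\<bar> ^ 4" by (simp add: power_even_abs)
    also have "\<dots> \<le> (2 ^ s * \<delta>) ^ 4"
      using abs_walsh_transform_le[OF assms(3)] by (intro power_mono) auto
    also have "\<dots> = 16 ^ s * \<delta> ^ 4"
      using power_mult[of "2::real" 4 s] power_mult[of "2::real" s 4]
      by (simp add: power_mult_distrib mult.commute)
    finally show "\<bar>cos (walsh_transform s t B) - (1 - (walsh_transform s t B)\<^sup>2 / 2)\<bar> \<le> 16 ^ s * \<delta> ^ 4" .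
  qed
  finally have "\<bar>step_charfun s t - q\<bar> \<le> 16 ^ s * \<delta> ^ 4" by (simp add: card_Pow)
  moreover have "\<bar>(\<Prod>T\<in>?P. cos (t T)) - q\<bar> \<le> (2 ^ s)\<^sup>2 * \<delta> ^ 4"
    using prod_cos_taylor[of ?P \<delta> t] assms by (simp add: q_def card_Pow)
  moreover have "((2::real) ^ s)\<^sup>2 * \<delta> ^ 4 \<le> 16 ^ s * \<delta> ^ 4"
    by (intro mult_right_mono) (simp_all add: power2_eq_square power_mono flip: power_mult_distrib)
  ultimately show ?thesis by linarith
qed

section \<open>Averages over random parallelepipeds\<close>

lemma UNIV_bit: "(UNIV :: bit set) = {0, 1}"
  by (auto intro: bit.exhaust)

lemma finite_UNIV_bit [simp]: "finite (UNIV :: bit set)"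
  by (simp add: UNIV_bit)

lemma card_UNIV_bit [simp]: "card (UNIV :: bit set) = 2"
  by (simp add: UNIV_bit)

definition bsign :: "bit \<Rightarrow> real" where
  "bsign b = (if b = 0 then 1 else -1)"

lemma bsign_add: "bsign (a + b) = bsign a * bsign b"
  by (cases a; cases b) (simp_all add: bsign_def)

lemma bsign_sum:
  assumes "finite T"
  shows "bsign (\<Sum>l\<in>T. z l) = (\<Prod>l\<in>T. bsign (z l))"
  using assms by induction (simp_all add: bsign_add, simp add: bsign_def)

text \<open>The bits \<open>z\<close> of the directions at one coordinate are encoded by the set of
  those equal to 1; this is where the Walsh characters enter.\<close>

lemma bsign_sum_chi:
  assumes "T \<subseteq> {1..s}"
  shows "bsign (\<Sum>l\<in>T. z l) = chi {l \<in> {1..s}. z l = 1} T"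
proof -
  have fin: "finite T" using assms finite_subset by blast
  have "(\<Prod>l\<in>T. bsign (z l)) = (-1) ^ card (T - {l. z l = 0})"
    using fin unfolding bsign_def by (simp add: prod.If_cases Diff_eq)
  also have "T - {l. z l = 0} = {l \<in> {1..s}. z l = 1} \<inter> T"
    using assms by auto
  finally show ?thesis
    using fin by (simp add: bsign_sum chi_def)
qed

lemma cis_sum: "cis (\<Sum>a\<in>A. f a) = (\<Prod>a\<in>A. cis (f a))"
  by (induction A rule: infinite_finite_induct) (simp_all flip: cis_mult)

text \<open>The pair \<open>(x, h)\<close> is a bit matrix with one column for each of the m
  coordinates. The columns can be chosen independently, so a product over columns sums to an m-th
  power.\<close>

lemma sum_cube_columns:
  fixes f :: "bit \<Rightarrow> (nat \<Rightarrow> bit) \<Rightarrow> complex"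
  shows "(\<Sum>(x, h)\<in>cube m \<times> ({1..s} \<rightarrow>\<^sub>E cube m). \<Prod>i<m. f (x i) (\<lambda>l\<in>{1..s}. h l i))
    = (\<Sum>(y, z)\<in>UNIV \<times> ({1..s} \<rightarrow>\<^sub>E UNIV). f y z) ^ m"
proof -
  let ?Z = "(UNIV :: bit set) \<times> ({1..s} \<rightarrow>\<^sub>E (UNIV :: bit set))"
  have "(\<Sum>(y, z)\<in>?Z. f y z) ^ m = (\<Prod>i<m. \<Sum>p\<in>?Z. f (fst p) (snd p))"
    by (simp add: case_prod_unfold)
  also have "\<dots> = (\<Sum>g\<in>PiE {..<m} (\<lambda>_. ?Z). \<Prod>i<m. f (fst (g i)) (snd (g i)))"
    by (rule prod_sum_PiE) (auto intro!: finite_PiE)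
  also have "\<dots> = (\<Sum>(x, h)\<in>cube m \<times> ({1..s} \<rightarrow>\<^sub>E cube m). \<Prod>i<m. f (x i) (\<lambda>l\<in>{1..s}. h l i))"
  proof (rule sum.reindex_bij_witness)
    \<comment> \<open>Transposition and its inverse. The default values have to match: 0 at the
      coordinates from m on, as \<open>cube\<close> demands, and undefined outside {1..s} and
      {..<m}, as the extensional function spaces demand.\<close>
    let ?i = "\<lambda>(x, h). \<lambda>i\<in>{..<m}. (x i, \<lambda>l\<in>{1..s}. h l i) :: bit \<times> (nat \<Rightarrow> bit)"
    let ?j = "\<lambda>g :: nat \<Rightarrow> bit \<times> (nat \<Rightarrow> bit). (\<lambda>i. if i < m then fst (g i) else 0,
       \<lambda>l\<in>{1..s}. \<lambda>i. if i < m then snd (g i) l else 0)"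
    fix g assume g: "g \<in> PiE {..<m} (\<lambda>_. ?Z)"
    have gi: "snd (g i) \<in> {1..s} \<rightarrow>\<^sub>E UNIV" if "i < m" for i
      using g that by (auto simp: PiE_iff mem_Times_iff)
    have col: "(\<lambda>l\<in>{1..s}. snd (?j g) l i) = snd (g i)" if "i < m" for i
    proof -
      have "(\<lambda>l\<in>{1..s}. snd (?j g) l i) = (\<lambda>l\<in>{1..s}. snd (g i) l)"
        using that by (auto simp: restrict_def)
      also have "\<dots> = snd (g i)"
        using gi[OF that] by (intro PiE_restrict)
      finally show ?thesis .
    qed
    show "?i (?j g) = g"
    proof
      fix i
      show "?i (?j g) i = g i"
      proof (cases "i < m")
        case True
        with col[OF True] show ?thesis by (simp add: prod_eq_iff)
      next
        case False
        then show ?thesis by (simp add: PiE_arb[OF g])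
      qed
    qed
    show "?j g \<in> cube m \<times> ({1..s} \<rightarrow>\<^sub>E cube m)"
      by (auto simp: cube_def)
    show "(case ?j g of (x, h) \<Rightarrow> \<Prod>i<m. f (x i) (\<lambda>l\<in>{1..s}. h l i)) = (\<Prod>i<m. f (fst (g i)) (snd (g i)))"
      using col by (auto intro!: prod.cong)
  next
    let ?i = "\<lambda>(x, h). \<lambda>i\<in>{..<m}. (x i, \<lambda>l\<in>{1..s}. h l i) :: bit \<times> (nat \<Rightarrow> bit)"
    let ?j = "\<lambda>g :: nat \<Rightarrow> bit \<times> (nat \<Rightarrow> bit). (\<lambda>i. if i < m then fst (g i) else 0,
       \<lambda>l\<in>{1..s}. \<lambda>i. if i < m then snd (g i) l else 0)"
    fix p assume p: "p \<in> cube m \<times> ({1..s} \<rightarrow>\<^sub>E cube m)"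
    obtain x h where ph: "p = (x, h)" "x \<in> cube m" "h \<in> {1..s} \<rightarrow>\<^sub>E cube m"
      using p by auto
    have "(\<lambda>l\<in>{1..s}. \<lambda>i. if i < m then h l i else 0) l = h l" for l
    proof (cases "l \<in> {1..s}")
      case True
      then have "h l \<in> cube m" using ph by auto
      with True show ?thesis by (auto simp: cube_def fun_eq_iff)
    next
      case False
      then show ?thesis using ph by (auto simp: PiE_iff extensional_def)
    qed
    moreover have "(\<lambda>l\<in>{1..s}. \<lambda>i. if i < m then snd (?i (x, h) i) l else 0)
        = (\<lambda>l\<in>{1..s}. \<lambda>i. if i < m then h l i else 0)"
      by (auto simp: restrict_def fun_eq_iff)
    moreover have "(\<lambda>i. if i < m then fst (?i (x, h) i) else 0) = x"
      using ph by (auto simp: cube_def fun_eq_iff)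
    ultimately show "?j (?i p) = p"
      unfolding ph(1) by (simp add: fun_eq_iff)
    show "?i p \<in> PiE {..<m} (\<lambda>_. ?Z)"
      unfolding ph(1) by auto
  qed
  finally show ?thesis ..
qed

text \<open>Counting is the instance of \<open>sum_cube_columns\<close> at the constant function
  1.\<close>

lemma card_cube_PiE: "card (cube m \<times> ({1..s} \<rightarrow>\<^sub>E cube m)) = (2 * 2 ^ s) ^ m"
proof -
  have "of_nat (card (cube m \<times> ({1..s} \<rightarrow>\<^sub>E cube m))) = (of_nat ((2 * 2 ^ s) ^ m) :: complex)"
    using sum_cube_columns[of "\<lambda>_ _. 1" s m]
    by (simp add: case_prod_unfold card_PiE card_cartesian_product)
  then show ?thesis
    using of_nat_eq_iff by blast
qed

lemma expectation_parallelepiped: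
  "uniform_expectation (cube m \<times> ({1..s} \<rightarrow>\<^sub>E cube m))
     (\<lambda>(x, h). \<Prod>T\<in>Pow {1..s}. cis (\<theta> T * (\<Sum>i<m. bsign (x i + (\<Sum>l\<in>T. h l i)))))
   = of_real (step_charfun s \<theta> ^ m)"
proof -
  define f where "f y z = cis (\<Sum>T\<in>Pow {1..s}. \<theta> T * bsign (y + (\<Sum>l\<in>T. z l)))"
    for y :: bit and z :: "nat \<Rightarrow> bit"
  have "(\<Prod>T\<in>Pow {1..s}. cis (\<theta> T * (\<Sum>i<m. bsign (x i + (\<Sum>l\<in>T. h l i)))))
      = (\<Prod>i<m. f (x i) (\<lambda>l\<in>{1..s}. h l i))" for x h
  proof -
    have "(\<Sum>l\<in>T. (\<lambda>l\<in>{1..s}. h l i) l) = (\<Sum>l\<in>T. h l i)" if "T \<in> Pow {1..s}" for T i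
      using that by (intro sum.cong) auto
    then have "f (x i) (\<lambda>l\<in>{1..s}. h l i) = cis (\<Sum>T\<in>Pow {1..s}. \<theta> T * bsign (x i + (\<Sum>l\<in>T. h l i)))" for i
      unfolding f_def by (intro arg_cong[where f = cis] sum.cong refl) metis
    then show ?thesis
      unfolding cis_sum[symmetric] sum_distrib_left
      by (simp only: flip: cis_sum) (subst sum.swap, rule refl)
  qed
  then have "(\<Sum>(x, h)\<in>cube m \<times> ({1..s} \<rightarrow>\<^sub>E cube m).
       \<Prod>T\<in>Pow {1..s}. cis (\<theta> T * (\<Sum>i<m. bsign (x i + (\<Sum>l\<in>T. h l i)))))
     = (\<Sum>(y, z)\<in>UNIV \<times> ({1..s} \<rightarrow>\<^sub>E UNIV). f y z) ^ m"
    using sum_cube_columns[of f s m] by simp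
  also have "(\<Sum>(y, z)\<in>UNIV \<times> ({1..s} \<rightarrow>\<^sub>E UNIV). f y z)
      = (\<Sum>z\<in>{1..s} \<rightarrow>\<^sub>E UNIV. f 0 z + f 1 z)"
    by (simp add: UNIV_bit flip: sum.cartesian_product)
      (simp add: sum.distrib)
  \<comment> \<open>The two base bits give opposite arguments, and the conjugate exponentials add up
    to twice a cosine.\<close>
  also have "\<dots> = (\<Sum>z\<in>{1..s} \<rightarrow>\<^sub>E (UNIV :: bit set). of_real (2 * cos (walsh_transform s \<theta> {l \<in> {1..s}. z l = 1})))"
  proof (intro sum.cong refl)
    fix z :: "nat \<Rightarrow> bit"
    let ?L = "walsh_transform s \<theta> {l \<in> {1..s}. z l = 1}"
    have "f y z = cis (bsign y * ?L)" for y
      unfolding f_def walsh_transform_def bsign_add sum_distrib_left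
      by (intro arg_cong[where f = cis] sum.cong refl) (simp add: bsign_sum_chi)
    then show "f 0 z + f 1 z = of_real (2 * cos ?L)"
      by (simp add: bsign_def complex_eq_iff)
  qed
  also have "\<dots> = (\<Sum>B\<in>Pow {1..s}. of_real (2 * cos (walsh_transform s \<theta> B)))"
    by (rule sum.reindex_bij_witness[where
          i = "\<lambda>B. \<lambda>l\<in>{1..s}. if l \<in> B then 1 else 0" and j = "\<lambda>z. {l \<in> {1..s}. z l = 1}"])
      (auto simp: fun_eq_iff PiE_iff extensional_def)
  also have "\<dots> = of_real (2 * 2 ^ s * step_charfun s \<theta>)"
    by (simp add: step_charfun_def flip: sum_distrib_left)
  finally show ?thesis
    by (simp add: uniform_expectation_def card_cube_PiE power_mult_distrib)
qed

text \<open>For s = 0 there is exactly one, empty, family of directions; so expectations over the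
  cube are the case s = 0 of statements on parallelepipeds.\<close>

lemma expectation_trivial_PiE:
  "uniform_expectation (A \<times> ({1..0::nat} \<rightarrow>\<^sub>E B)) (\<lambda>(x, h). f x) = uniform_expectation A f"
  by (simp add: uniform_expectation_def card_cartesian_product flip: sum.cartesian_product)

lemma step_charfun_0: "step_charfun 0 \<theta> = cos (\<theta> {})"
  by (simp add: step_charfun_def walsh_transform_def chi_def)

lemma expectation_cube_cis:
  "uniform_expectation (cube m) (\<lambda>x. cis (\<theta> * (\<Sum>i<m. bsign (x i)))) = of_real (cos \<theta> ^ m)"
  using expectation_parallelepiped[of m 0 "\<lambda>_. \<theta>"]
    expectation_trivial_PiE[of "cube m" "cube m" "\<lambda>x. cis (\<theta> * (\<Sum>i<m. bsign (x i)))"]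
  by (simp add: step_charfun_0)

lemma card_cube: "card (cube m) = 2 ^ m"
  using card_cube_PiE[of m 0] by (simp add: card_cartesian_product)

lemma finite_cube: "finite (cube m)"
  by (rule card_ge_0_finite) (simp add: card_cube)

lemma cube_support: "x \<in> cube m \<Longrightarrow> {i. x i = 1} \<subseteq> {..<m}"
  by (rule subsetI, rule ccontr) (auto simp: cube_def)

lemma sum_bsign_cube:
  assumes "x \<in> cube m"
  shows "(\<Sum>i<m. bsign (x i)) = real_of_int (int m - 2 * int (hamming_weight x))"
proof -
  have "(\<Sum>i<m. bsign (x i)) = (\<Sum>i<m. 1 - 2 * (if x i = 1 then 1 else 0))"
    by (intro sum.cong) (auto simp: bsign_def)
  also have "\<dots> = real m - 2 * real (card ({..<m} \<inter> {i. x i = 1}))"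
    by (simp add: sum_subtractf sum.If_cases flip: sum_distrib_left)
  also have "{..<m} \<inter> {i. x i = 1} = {i. x i = 1}"
    using cube_support[OF assms] by auto
  finally show ?thesis by (simp add: hamming_weight_def)
qed

lemma hamming_weight_le: "x \<in> cube m \<Longrightarrow> hamming_weight x \<le> m"
  unfolding hamming_weight_def
  using card_mono[OF _ cube_support, of m x] by simp

section \<open>Divisibility filters from roots of unity\<close>

lemma sum_roots_of_unity:
  assumes "N > 0"
  shows "(\<Sum>j<N. cis (2 * pi * real j / real N * of_int S)) = (if int N dvd S then of_nat N else 0)"
proof -
  define w where "w = cis (2 * pi * S / N)"
  have pw: "cis (2 * pi * real j / real N * of_int S) = w ^ j" for j
    by (simp add: w_def DeMoivre mult_ac)
  have wN: "w ^ N = 1"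
    using assms cis_multiple_2pi[of "of_int S"] by (simp add: w_def DeMoivre)
  show ?thesis
  proof (cases "w = 1")
    case True
    then have "cos (2 * pi * S / N) = 1"
      by (simp add: w_def complex_eq_iff)
    then obtain c :: int where "2 * pi * S / N = real_of_int c * 2 * pi"
      using cos_one_2pi_int by blast
    then have "S = of_int c * real N"
      using assms by (simp add: field_simps)
    then have "S = c * int N"
      by (metis of_int_eq_iff of_int_mult of_int_of_nat_eq)
    then have "int N dvd S" by simp
    with True show ?thesis by (simp only: pw) simp
  next
    case False
    have "\<not> int N dvd S"
    proof
      assume "int N dvd S"
      then obtain c where "S = int N * c" by auto
      with assms have "w = cis (2 * pi * of_int c)" by (simp add: w_def mult.assoc del: cis_multiple_2pi)
      then have "w = 1"
        using cis_multiple_2pi[of "real_of_int c"] by simp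
      with False show False ..
    qed
    moreover have "(\<Sum>j<N. w ^ j) = 0"
      using geometric_sum[OF False, of N] wN by simp
    ultimately show ?thesis by (simp only: pw) simp
  qed
qed

text \<open>The symmetric range lets the offsets \<open>r\<close> lie on both sides of a peak.
  Shifting the index by n costs a factor that is 1 when 2n + 1 divides S; otherwise the sum is 0
  anyway.\<close>

lemma sum_roots_of_unity_symmetric:
  "(\<Sum>r\<in>{-int n..int n}. cis (2 * pi * of_int r / real (2 * n + 1) * of_int S))
     = (if int (2 * n + 1) dvd S then of_nat (2 * n + 1) else 0)"
proof -
  let ?N = "2 * n + 1"
  have "(\<Sum>r\<in>{-int n..int n}. cis (2 * pi * of_int r / real ?N * of_int S))
      = (\<Sum>j<?N. cis (2 * pi * of_int (int j - int n) / real ?N * of_int S))"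
    by (rule sum.reindex_bij_witness[where i = "\<lambda>j. int j - int n" and j = "\<lambda>r. nat (r + int n)"]) auto
  also have "\<dots> = (\<Sum>j<?N. cis (2 * pi * real j / real ?N * of_int S)) * cis (- (2 * pi * real n / real ?N * of_int S))"
    unfolding sum_distrib_right cis_mult
    by (intro sum.cong refl arg_cong[where f = cis])
      (simp add: diff_divide_distrib right_diff_distrib left_diff_distrib)
  also have "\<dots> = (if int ?N dvd S then of_nat ?N else 0)"
  proof (cases "int ?N dvd S")
    case True
    then obtain c where c: "S = int ?N * c" by blast
    have "cis (- (2 * pi * real n / real ?N * of_int S)) = cis (2 * pi * of_int (- (int n * c)))"
      unfolding c by (intro arg_cong[where f = cis]) (simp add: field_simps)
    also have "\<dots> = 1" by (rule cis_multiple_2pi) auto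
    finally show ?thesis
      using True by (subst sum_roots_of_unity) auto
  next
    case False
    then show ?thesis by (subst sum_roots_of_unity) auto
  qed
  finally show ?thesis .
qed

section \<open>Fourier expansion\<close>

definition slice_density :: "nat \<Rightarrow> real" where
  "slice_density n = card (middle_slice n) / 2 ^ (2 * n)"

definition mod_density :: "nat \<Rightarrow> nat \<Rightarrow> real" where
  "mod_density n k = card (mod_slice n k) / 2 ^ (2 * n)"

text \<open>The index \<open>j\<close> runs through the candidates for peaks, and \<open>r\<close>
  through a fine grid around each of them.\<close>

definition freq :: "nat \<Rightarrow> nat \<Rightarrow> nat \<Rightarrow> int \<Rightarrow> real" where
  "freq n k j r = 2 * pi * real j / 2 ^ k + 2 * pi * of_int r / (2 ^ k * real (2 * n + 1))"

text \<open>The middle slice has one and the same coefficient at all frequencies; the modular slice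
  lives on r = 0 alone, again with equal coefficients. Hence there is no dependence on
  \<open>j\<close>.\<close>

definition coef :: "nat \<Rightarrow> nat \<Rightarrow> int \<Rightarrow> real" where
  "coef n k r = 1 / (2 ^ k * real (2 * n + 1) * slice_density n)
     - (if r = 0 then 1 / (2 ^ k * mod_density n k) else 0)"

definition slice_difference :: "nat \<Rightarrow> nat \<Rightarrow> (nat \<Rightarrow> bit) \<Rightarrow> complex" where
  "slice_difference n k x = normalized_indicator (2 * n) (middle_slice n) x
     - normalized_indicator (2 * n) (mod_slice n k) x"

lemma uniform_expectation_indicator:
  assumes "A \<subseteq> cube m"
  shows "uniform_expectation (cube m) (indicator A) = of_real (card A / 2 ^ m)"
proof -
  have "(\<Sum>x\<in>cube m. indicator A x) = (of_nat (card (cube m \<inter> A)) :: complex)"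
    using sum_indicator_eq_card[OF finite_cube] by (simp add: indicator_def sum.If_cases finite_cube)
  also have "cube m \<inter> A = A" using assms by auto
  finally show ?thesis
    by (simp add: uniform_expectation_def card_cube)
qed

lemma slices_subset_cube: "middle_slice n \<subseteq> cube (2 * n)" "mod_slice n k \<subseteq> cube (2 * n)"
  by (auto simp: middle_slice_def mod_slice_def)

lemma slice_difference_eq:
  "slice_difference n k x = of_real (indicator (middle_slice n) x / slice_density n
     - indicator (mod_slice n k) x / mod_density n k)"
  by (simp add: slice_difference_def normalized_indicator_def slice_density_def mod_density_def
      uniform_expectation_indicator slices_subset_cube indicator_def)

text \<open>The sum of signs is twice n - |x|, so divisibility by 2^k becomes a congruence modulo
  2^(k - 1) after cancelling one factor 2, which uses 1 \<le> k.\<close>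

lemma mod_slice_fourier:
  assumes "1 \<le> k" "x \<in> cube (2 * n)"
  shows "(\<Sum>j<2 ^ k. cis (2 * pi * real j / 2 ^ k * (\<Sum>i<2 * n. bsign (x i))))
    = 2 ^ k * indicator (mod_slice n k) x"
proof -
  let ?w = "hamming_weight x"
  have "(2::int) ^ k = 2 * 2 ^ (k - 1)"
    using assms by (simp flip: power_Suc)
  moreover have "int (2 * n) - 2 * int ?w = 2 * (int n - int ?w)" by simp
  ultimately have "2 ^ k dvd int (2 * n) - 2 * int ?w \<longleftrightarrow> 2 ^ (k - 1) dvd int n - int ?w"
    by (simp only: dvd_mult_cancel_left) simp
  also have "\<dots> \<longleftrightarrow> [int n = int ?w] (mod int (2 ^ (k - 1)))"
    by (simp add: cong_iff_dvd_diff)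
  also have "\<dots> \<longleftrightarrow> x \<in> mod_slice n k"
    unfolding cong_int_iff using assms by (auto simp: mod_slice_def cong_sym_eq)
  finally show ?thesis
    using sum_roots_of_unity[of "2 ^ k" "int (2 * n) - 2 * int ?w"]
    by (simp add: sum_bsign_cube[OF assms(2)])
qed

text \<open>The double sum factors: the sum over \<open>j\<close> tests whether 2^k divides S, and
  then the sum over \<open>r\<close> tests whether 2n + 1 divides S / 2^k. As |S| \<le> 2n, only S =
  0 passes both.\<close>

lemma middle_slice_fourier:
  assumes "x \<in> cube (2 * n)"
  shows "(\<Sum>j<2 ^ k. \<Sum>r\<in>{-int n..int n}. cis (freq n k j r * (\<Sum>i<2 * n. bsign (x i))))
    = 2 ^ k * of_nat (2 * n + 1) * indicator (middle_slice n) x"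
proof -
  define S where "S = int (2 * n) - 2 * int (hamming_weight x)"
  have S: "(\<Sum>i<2 * n. bsign (x i)) = of_int S"
    by (simp add: S_def sum_bsign_cube[OF assms])
  have mem: "x \<in> middle_slice n \<longleftrightarrow> S = 0"
    using assms by (auto simp: S_def middle_slice_def)
  have "hamming_weight x \<le> 2 * n" using assms by (rule hamming_weight_le)
  then have S_le: "\<bar>S\<bar> \<le> 2 * int n" by (simp add: S_def)
  have "(\<Sum>j<2 ^ k. \<Sum>r\<in>{-int n..int n}. cis (freq n k j r * of_int S))
      = (\<Sum>j<2 ^ k. cis (2 * pi * real j / 2 ^ k * of_int S))
        * (\<Sum>r\<in>{-int n..int n}. cis (2 * pi * of_int r / (2 ^ k * real (2 * n + 1)) * of_int S))"
    by (simp only: sum_product cis_mult freq_def distrib_right)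
  also have "\<dots> = 2 ^ k * of_nat (2 * n + 1) * indicator (middle_slice n) x"
  proof (cases "2 ^ k dvd S")
    case False
    then have "x \<notin> middle_slice n" using mem by auto
    with False show ?thesis
      using sum_roots_of_unity[of "2 ^ k" S] by simp
  next
    case True
    then obtain S' where S': "S = 2 ^ k * S'" by blast
    have "\<bar>S'\<bar> * 1 \<le> \<bar>S'\<bar> * 2 ^ k" by (intro mult_left_mono) auto
    then have "\<bar>S'\<bar> \<le> \<bar>S\<bar>" by (simp add: S' abs_mult mult.commute)
    then have "int (2 * n + 1) dvd S' \<longleftrightarrow> S' = 0"
      using S_le zdvd_imp_le[of "int (2 * n + 1)" "\<bar>S'\<bar>"] by auto
    moreover have "(\<Sum>r\<in>{-int n..int n}. cis (2 * pi * of_int r / (2 ^ k * real (2 * n + 1)) * of_int S))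
        = (\<Sum>r\<in>{-int n..int n}. cis (2 * pi * of_int r / real (2 * n + 1) * of_int S'))"
      by (intro sum.cong refl arg_cong[where f = cis]) (simp add: S')
    ultimately show ?thesis
      using True sum_roots_of_unity[of "2 ^ k" S] sum_roots_of_unity_symmetric[of n S'] mem S'
      by (simp add: mult_ac)
  qed
  finally show ?thesis by (simp only: S)
qed

lemma slice_difference_fourier:
  assumes "1 \<le> k" "x \<in> cube (2 * n)"
  shows "slice_difference n k x = (\<Sum>j<2 ^ k. \<Sum>r\<in>{-int n..int n}.
    of_real (coef n k r) * cis (freq n k j r * (\<Sum>i<2 * n. bsign (x i))))"
proof -
  let ?S = "\<Sum>i<2 * n. bsign (x i)"
  let ?u = "of_real (1 / (2 ^ k * real (2 * n + 1) * slice_density n)) :: complex"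
  let ?v = "of_real (1 / (2 ^ k * mod_density n k)) :: complex"
  have "(\<Sum>r\<in>{-int n..int n}. of_real (coef n k r) * cis (freq n k j r * ?S))
      = ?u * (\<Sum>r\<in>{-int n..int n}. cis (freq n k j r * ?S)) - ?v * cis (2 * pi * real j / 2 ^ k * ?S)" for j
  proof -
    have "(\<Sum>r\<in>{-int n..int n}. of_real (coef n k r) * cis (freq n k j r * ?S))
       = (\<Sum>r\<in>{-int n..int n}. ?u * cis (freq n k j r * ?S)
           - (if r = 0 then ?v * cis (freq n k j 0 * ?S) else 0))"
      by (intro sum.cong refl) (simp add: coef_def left_diff_distrib)
    also have "\<dots> = ?u * (\<Sum>r\<in>{-int n..int n}. cis (freq n k j r * ?S)) - ?v * cis (freq n k j 0 * ?S)"
      by (simp only: sum_subtractf sum_distrib_left[symmetric] sum.delta finite_atLeastAtMost_int) simp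
    finally show ?thesis by (simp add: freq_def)
  qed
  then have "(\<Sum>j<2 ^ k. \<Sum>r\<in>{-int n..int n}. of_real (coef n k r) * cis (freq n k j r * ?S))
     = ?u * (\<Sum>j<2 ^ k. \<Sum>r\<in>{-int n..int n}. cis (freq n k j r * ?S))
       - ?v * (\<Sum>j<2 ^ k. cis (2 * pi * real j / 2 ^ k * ?S))"
    by (simp only: sum_subtractf sum_distrib_left)
  also have "\<dots> = slice_difference n k x"
    unfolding mod_slice_fourier[OF assms] middle_slice_fourier[OF assms(2)] slice_difference_eq
    using of_nat_neq_0[of "2 * n", where 'a = complex] by (simp add: indicator_def add.commute)
  finally show ?thesis ..
qed

section \<open>The Gowers average on the Fourier side\<close>

lemma cnj_pow_real: "cnj z = z \<Longrightarrow> (cnj ^^ c) z = z"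
  by (induction c) auto

lemma uniform_expectation_sum:
  "uniform_expectation A (\<lambda>p. \<Sum>j\<in>J. f j p) = (\<Sum>j\<in>J. uniform_expectation A (f j))"
  unfolding uniform_expectation_def by (subst sum.swap) (simp add: sum_divide_distrib)

lemma uniform_expectation_mult:
  "uniform_expectation A (\<lambda>p. c * f p) = c * uniform_expectation A f"
  by (simp add: uniform_expectation_def sum_distrib_left)

lemma uniform_expectation_diff_divide:
  "uniform_expectation A (\<lambda>p. f p / u - g p / v) = uniform_expectation A f / u - uniform_expectation A g / v"
  by (simp add: uniform_expectation_def sum_subtractf diff_divide_distrib mult.commute flip: sum_divide_distrib)

text \<open>Expanding the product over the corners leaves one character per corner, and
  \<open>expectation_parallelepiped\<close> evaluates the expectation of each product of
  characters.\<close>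

lemma gowers_average_fourier:
  assumes "1 \<le> k"
  shows "gowers_average (2 * n) s (slice_difference n k)
    = of_real (\<Sum>j\<in>Pow {1..s} \<rightarrow>\<^sub>E {..<2 ^ k}. \<Sum>r\<in>Pow {1..s} \<rightarrow>\<^sub>E {-int n..int n}.
        (\<Prod>T\<in>Pow {1..s}. coef n k (r T)) * step_charfun s (\<lambda>T. freq n k (j T) (r T)) ^ (2 * n))"
proof -
  let ?P = "Pow {1..s}"
  let ?A = "cube (2 * n) \<times> ({1..s} \<rightarrow>\<^sub>E cube (2 * n))"
  let ?S = "\<lambda>x h T. \<Sum>i<2 * n. bsign (x i + (\<Sum>l\<in>T. h l i))"
  have "(\<Prod>T\<in>?P. (cnj ^^ card T) (slice_difference n k (\<lambda>i. x i + (\<Sum>l\<in>T. h l i))))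
      = (\<Sum>j\<in>?P \<rightarrow>\<^sub>E {..<2 ^ k}. \<Sum>r\<in>?P \<rightarrow>\<^sub>E {-int n..int n}.
          of_real (\<Prod>T\<in>?P. coef n k (r T)) * (\<Prod>T\<in>?P. cis (freq n k (j T) (r T) * ?S x h T)))"
    if "(x, h) \<in> ?A" for x h
  proof -
    have "(cnj ^^ card T) (slice_difference n k (\<lambda>i. x i + (\<Sum>l\<in>T. h l i)))
        = (\<Sum>j<2 ^ k. \<Sum>r\<in>{-int n..int n}. of_real (coef n k r) * cis (freq n k j r * ?S x h T))"
      if T: "T \<in> ?P" for T
    proof -
      have "h l i = 0" if "l \<in> T" "i \<ge> 2 * n" for l i
      proof -
        have "h l \<in> cube (2 * n)"
          using \<open>(x, h) \<in> ?A\<close> T that by (auto simp: PiE_iff)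
        then show ?thesis using that by (simp add: cube_def)
      qed
      then have "(\<lambda>i. x i + (\<Sum>l\<in>T. h l i)) \<in> cube (2 * n)"
        using \<open>(x, h) \<in> ?A\<close> by (simp add: cube_def)
      note fourier = slice_difference_fourier[OF assms this]
      \<comment> \<open>The difference is real-valued, so the conjugations have no effect.\<close>
      have "(cnj ^^ c) (slice_difference n k y) = slice_difference n k y" for c y
        by (rule cnj_pow_real) (simp only: slice_difference_eq complex_cnj_complex_of_real)
      then show ?thesis
        by (rule trans) (rule fourier)
    qed
    then have "(\<Prod>T\<in>?P. (cnj ^^ card T) (slice_difference n k (\<lambda>i. x i + (\<Sum>l\<in>T. h l i))))
        = (\<Prod>T\<in>?P. \<Sum>j<2 ^ k. \<Sum>r\<in>{-int n..int n}. of_real (coef n k r) * cis (freq n k j r * ?S x h T))"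
      by (rule prod.cong[OF refl])
    then show ?thesis
      by (simp add: prod_sum_PiE finite_PiE prod.distrib)
  qed
  then have "gowers_average (2 * n) s (slice_difference n k)
      = uniform_expectation ?A (\<lambda>p. \<Sum>j\<in>?P \<rightarrow>\<^sub>E {..<2 ^ k}. \<Sum>r\<in>?P \<rightarrow>\<^sub>E {-int n..int n}.
          of_real (\<Prod>T\<in>?P. coef n k (r T)) *
            (case p of (x, h) \<Rightarrow> \<Prod>T\<in>?P. cis (freq n k (j T) (r T) * ?S x h T)))"
    unfolding gowers_average_def uniform_expectation_def
    by (intro arg_cong[where f = "\<lambda>z. z / _"] sum.cong refl) auto
  then show ?thesis
    by (simp only: uniform_expectation_sum uniform_expectation_mult expectation_parallelepiped
        of_real_sum of_real_mult)
qed

section \<open>Lower bounds for the densities, and the mean of the difference\<close>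

lemma mod_density_ge:
  assumes "1 \<le> k"
  shows "mod_density n k \<ge> 1 / 2 ^ k"
proof -
  let ?f = "\<lambda>j x. cis (2 * pi * real j / 2 ^ k * (\<Sum>i<2 * n. bsign (x i)))"
  have "2 ^ k * of_real (mod_density n k)
      = uniform_expectation (cube (2 * n)) (\<lambda>x. 2 ^ k * indicator (mod_slice n k) x)"
    using uniform_expectation_indicator[OF slices_subset_cube(2)]
    by (simp add: uniform_expectation_mult mod_density_def)
  also have "\<dots> = uniform_expectation (cube (2 * n)) (\<lambda>x. \<Sum>j<2 ^ k. ?f j x)"
    unfolding uniform_expectation_def
    by (intro arg_cong[where f = "\<lambda>z. z / _"] sum.cong refl mod_slice_fourier[OF assms, symmetric])
  also have "\<dots> = of_real (\<Sum>j<2 ^ k. cos (2 * pi * real j / 2 ^ k) ^ (2 * n))"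
    by (simp only: uniform_expectation_sum expectation_cube_cis of_real_sum)
  finally have "complex_of_real (2 ^ k * mod_density n k)
      = complex_of_real (\<Sum>j<2 ^ k. cos (2 * pi * real j / 2 ^ k) ^ (2 * n))"
    by simp
  then have "2 ^ k * mod_density n k = (\<Sum>j<2 ^ k. cos (2 * pi * real j / 2 ^ k) ^ (2 * n))"
    by (simp only: of_real_eq_iff)
  \<comment> \<open>All terms are even powers, and j = 0 alone contributes 1.\<close>
  also have "\<dots> \<ge> (\<Sum>j\<in>{0}. cos (2 * pi * real j / 2 ^ k) ^ (2 * n))"
    by (intro sum_mono2) (auto simp: power_mult)
  finally show ?thesis by (simp add: field_simps)
qed

lemma card_middle_slice: "card (middle_slice n) = (2 * n) choose n"
proof -
  have "bij_betw (\<lambda>x. {i. x i = 1}) (middle_slice n) {B. B \<subseteq> {..<2 * n} \<and> card B = n}"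
  proof (rule bij_betw_byWitness[where f' = "\<lambda>B i. if i \<in> B then 1 else 0"])
    show "(\<lambda>B i. if i \<in> B then 1 else 0) ` {B. B \<subseteq> {..<2 * n} \<and> card B = n} \<subseteq> middle_slice n"
      by (auto simp: middle_slice_def cube_def hamming_weight_def)
  qed (use cube_support in \<open>auto simp: middle_slice_def hamming_weight_def fun_eq_iff\<close>)
  then show ?thesis
    by (simp add: bij_betw_same_card n_subsets)
qed

text \<open>The bound 4^n / (2 sqrt n) for the central binomial coefficient, squared to stay in the
  integers. The induction uses the ratio 2 (2n + 1) / (n + 1) of consecutive coefficients and 4 n (n
  + 1) \<le> (2n + 1)^2.\<close>

lemma central_binomial_sq_ge:
  assumes "1 \<le> n"
  shows "16 ^ n \<le> 4 * n * ((2 * n) choose n)\<^sup>2"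
  using assms
proof (induction n rule: dec_induct)
  case base
  then show ?case by (simp add: numeral_2_eq_2 One_nat_def)
next
  case (step n)
  define a where "a = (2 * n) choose n"
  define b where "b = (2 * Suc n) choose Suc n"
  have "Suc n * b = 2 * (2 * n + 1) * a"
  proof -
    have "Suc n * b = (2 * Suc n) * ((2 * n + 1) choose n)"
      using Suc_times_binomial_eq[of "2 * n + 1" n] by (simp add: b_def One_nat_def)
    also have "(2 * n + 1) choose n = (2 * n + 1) choose Suc n"
      using binomial_symmetric[of n "2 * n + 1"] by (simp add: Suc_eq_plus1)
    finally have "Suc n * b = 2 * (Suc n * ((2 * n + 1) choose Suc n))" by simp
    also have "Suc n * ((2 * n + 1) choose Suc n) = (2 * n + 1) * a"
      using Suc_times_binomial_eq[of "2 * n" n] by (metis a_def Suc_eq_plus1 mult.commute)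
    finally show ?thesis by (simp add: algebra_simps)
  qed
  then have "(Suc n * b)\<^sup>2 = 4 * (2 * n + 1)\<^sup>2 * a\<^sup>2"
    by (simp only: power_mult_distrib) simp
  then have "Suc n * (4 * Suc n * b\<^sup>2) = 16 * ((2 * n + 1)\<^sup>2 * a\<^sup>2)"
    by (simp add: power2_eq_square algebra_simps)
  moreover have "4 * n * (n + 1) * a\<^sup>2 \<le> (2 * n + 1)\<^sup>2 * a\<^sup>2"
    by (intro mult_right_mono) (auto simp: power2_eq_square algebra_simps)
  moreover have "(n + 1) * 16 ^ n \<le> (n + 1) * (4 * n * a\<^sup>2)"
    using step.IH by (intro mult_left_mono) (auto simp: a_def)
  ultimately have "Suc n * 16 ^ Suc n \<le> Suc n * (4 * Suc n * b\<^sup>2)"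
    by (simp add: algebra_simps)
  then show ?case
    unfolding b_def by (simp only: mult_le_cancel1 zero_less_Suc)
qed

lemma slice_density_ge:
  assumes "1 \<le> n"
  shows "slice_density n \<ge> 1 / (2 * sqrt n)"
proof -
  have "real (16 ^ n) \<le> real (4 * n * ((2 * n) choose n)\<^sup>2)"
    using central_binomial_sq_ge[OF assms] by (simp only: of_nat_le_iff)
  then have "(4 ^ n)\<^sup>2 \<le> (2 * sqrt n * ((2 * n) choose n))\<^sup>2"
    using power_mult_distrib[of "4::real" 4 n] by (simp add: power_mult_distrib power2_eq_square[of "4 ^ n"])
  then have "4 ^ n \<le> 2 * sqrt n * ((2 * n) choose n)"
    by (rule power2_le_imp_le) simp
  moreover have "(2::real) ^ (2 * n) = 4 ^ n" by (simp add: power_mult)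
  ultimately show ?thesis
    using assms by (simp add: slice_density_def card_middle_slice field_simps)
qed

text \<open>Both normalized indicators have mean 1, as their densities are positive. The
  cancellation between the two slices enters the estimate only here.\<close>

lemma gowers_average_0_eq_0:
  assumes "1 \<le> k" "1 \<le> n"
  shows "gowers_average (2 * n) 0 (slice_difference n k) = 0"
proof -
  have "0 < 1 / (2 * sqrt n)" "0 < 1 / (2::real) ^ k" using assms by auto
  with assms slice_density_ge[of n] mod_density_ge[of k n]
  have pos: "slice_density n > 0" "mod_density n k > 0"
    by (meson less_le_trans)+
  have ind: "uniform_expectation (cube (2 * n)) (indicator (middle_slice n)) = of_real (slice_density n)"
    "uniform_expectation (cube (2 * n)) (indicator (mod_slice n k)) = of_real (mod_density n k)"
    by (simp_all only: uniform_expectation_indicator slices_subset_cube slice_density_def mod_density_def)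
  have "gowers_average (2 * n) 0 (slice_difference n k)
      = uniform_expectation (cube (2 * n)) (slice_difference n k)"
    using expectation_trivial_PiE[of "cube (2 * n)" "cube (2 * n)" "slice_difference n k"]
    by (simp add: gowers_average_def)
  also have "\<dots> = uniform_expectation (cube (2 * n)) (indicator (middle_slice n)) / of_real (slice_density n)
     - uniform_expectation (cube (2 * n)) (indicator (mod_slice n k)) / of_real (mod_density n k)"
    unfolding slice_difference_def normalized_indicator_def ind
    by (simp only: uniform_expectation_diff_divide ind)
  finally show ?thesis using pos by (simp add: ind)
qed

section \<open>Peaks and tails\<close>

definition small_freq :: "nat \<Rightarrow> nat \<Rightarrow> int \<Rightarrow> real" where
  "small_freq n k r = 2 * pi * of_int r / (2 ^ k * real (2 * n + 1))"

definition window :: "nat \<Rightarrow> nat \<Rightarrow> real \<Rightarrow> int set" where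
  "window n k \<delta> = {r \<in> {-int n..int n}. \<bar>small_freq n k r\<bar> \<le> \<delta>}"

text \<open>The part of the Fourier sum near frequency 0. Each peak contributes a copy of it, since
  the sign at the peak disappears in the even power 2n.\<close>

definition main_term :: "nat \<Rightarrow> nat \<Rightarrow> nat \<Rightarrow> real \<Rightarrow> real" where
  "main_term n k s \<delta> = (\<Sum>r\<in>Pow {1..s} \<rightarrow>\<^sub>E window n k \<delta>.
     (\<Prod>T\<in>Pow {1..s}. coef n k (r T)) * step_charfun s (\<lambda>T. small_freq n k (r T)) ^ (2 * n))"

text \<open>A crude bound for all terms off the windows: there are (2n + 1)^(2^s) families
  \<open>r\<close>, the coefficients are at most 2 in absolute value, and
  \<open>step_charfun\<close> is at most the threshold of
  \<open>step_charfun_large_imp\<close>.\<close>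

definition off_peak_bound :: "nat \<Rightarrow> nat \<Rightarrow> real \<Rightarrow> real" where
  "off_peak_bound n s \<delta> = (2 * real (2 * n + 1)) ^ (2 ^ s) * (1 - (1 - cos \<delta>) / 2 ^ s) ^ (2 * n)"

definition inner_sum :: "nat \<Rightarrow> nat \<Rightarrow> nat \<Rightarrow> (nat set \<Rightarrow> nat) \<Rightarrow> real" where
  "inner_sum n k s j = (\<Sum>r\<in>Pow {1..s} \<rightarrow>\<^sub>E {-int n..int n}.
     (\<Prod>T\<in>Pow {1..s}. coef n k (r T)) * step_charfun s (\<lambda>T. freq n k (j T) (r T)) ^ (2 * n))"

definition peak :: "nat \<Rightarrow> nat \<Rightarrow> (nat set \<Rightarrow> nat) \<Rightarrow> bool" where
  "peak k s j \<longleftrightarrow> (\<exists>\<sigma>. \<bar>\<sigma>\<bar> = 1 \<and>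
     (\<forall>u. step_charfun s (\<lambda>T. 2 * pi * real (j T) / 2 ^ k + u T) = \<sigma> * step_charfun s u))"

lemma freq_eq: "freq n k j r = 2 * pi * real j / 2 ^ k + small_freq n k r"
  by (simp add: freq_def small_freq_def)

lemma finite_window [simp]: "finite (window n k \<delta>)"
  by (rule finite_subset[of _ "{-int n..int n}"]) (auto simp: window_def)

lemma abs_small_freq_less:
  assumes "r \<in> {-int n..int n}"
  shows "\<bar>small_freq n k r\<bar> < pi / 2 ^ k"
proof -
  have "\<bar>real_of_int r\<bar> \<le> real n" using assms by (simp add: abs_le_iff)
  then have "2 * \<bar>real_of_int r\<bar> / real (2 * n + 1) < 1" by simp
  then have "pi / 2 ^ k * (2 * \<bar>real_of_int r\<bar> / real (2 * n + 1)) < pi / 2 ^ k * 1"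
    by (intro mult_strict_left_mono) auto
  also have "pi / 2 ^ k * (2 * \<bar>real_of_int r\<bar> / real (2 * n + 1)) = \<bar>small_freq n k r\<bar>"
    by (simp add: small_freq_def abs_mult abs_divide)
  finally show ?thesis by simp
qed

text \<open>The bound \<open>slice_density_ge\<close> makes (2n + 1) times the slice density at
  least sqrt n, and \<open>mod_density_ge\<close> makes the extra term at r = 0 at most 1.\<close>

lemma abs_coef_le:
  assumes "1 \<le> k" "1 \<le> n"
  shows "\<bar>coef n k r\<bar> \<le> 1 / (2 ^ k * sqrt n) + (if r = 0 then 1 else 0)"
proof -
  have "sqrt n * sqrt n = n" by simp
  then have "sqrt n = 2 * real n * (1 / (2 * sqrt n))"
    using assms by (simp add: field_simps)
  also have "\<dots> \<le> real (2 * n + 1) * slice_density n"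
    using slice_density_ge[OF assms(2)] by (intro mult_mono) auto
  finally have "2 ^ k * sqrt n \<le> 2 ^ k * real (2 * n + 1) * slice_density n"
    by (simp add: mult.assoc)
  moreover have "0 < 2 ^ k * sqrt n" using assms by simp
  ultimately have u: "0 \<le> 1 / (2 ^ k * real (2 * n + 1) * slice_density n)"
      "1 / (2 ^ k * real (2 * n + 1) * slice_density n) \<le> 1 / (2 ^ k * sqrt n)"
    by (simp_all only: zero_le_divide_1_iff frac_le order.refl zero_le_one)
  have "1 \<le> 2 ^ k * mod_density n k"
    using mod_density_ge[OF assms(1), of n] by (simp add: field_simps)
  then have v: "0 \<le> 1 / (2 ^ k * mod_density n k)" "1 / (2 ^ k * mod_density n k) \<le> 1"
    by (auto simp: divide_le_eq zero_le_divide_iff)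
  show ?thesis
    unfolding coef_def using u v by (cases "r = 0"; simp only: simp_thms if_True if_False; linarith)
qed

lemma abs_coef_le_2:
  assumes "1 \<le> k" "1 \<le> n"
  shows "\<bar>coef n k r\<bar> \<le> 2"
proof -
  have "1 * 1 \<le> 2 ^ k * sqrt n" using assms by (intro mult_mono) auto
  then have "1 / (2 ^ k * sqrt n) \<le> 1" by (simp add: divide_le_eq)
  then show ?thesis using abs_coef_le[OF assms, of r] by (auto split: if_splits)
qed

lemma summand_le:
  assumes "1 \<le> k" "1 \<le> n" "\<bar>step_charfun s \<theta>\<bar> \<le> c"
  shows "\<bar>(\<Prod>T\<in>Pow {1..s}. coef n k (r T)) * step_charfun s \<theta> ^ (2 * n)\<bar> \<le> 2 ^ (2 ^ s) * c ^ (2 * n)"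
proof -
  have "(\<Prod>T\<in>Pow {1..s}. \<bar>coef n k (r T)\<bar>) \<le> (\<Prod>T\<in>Pow {1..s}. 2)"
    using abs_coef_le_2[OF assms(1,2)] by (intro prod_mono) auto
  moreover have "\<bar>step_charfun s \<theta>\<bar> ^ (2 * n) \<le> c ^ (2 * n)"
    using assms by (intro power_mono) auto
  ultimately show ?thesis
    by (simp only: abs_mult power_abs abs_prod) (intro mult_mono, auto simp: card_Pow prod_nonneg)
qed

lemma sum_summands_le:
  assumes "1 \<le> k" "1 \<le> n" "R \<subseteq> Pow {1..s} \<rightarrow>\<^sub>E {-int n..int n}"
    and "\<And>r. r \<in> R \<Longrightarrow> \<bar>step_charfun s (\<theta> r)\<bar> \<le> 1 - (1 - cos \<delta>) / 2 ^ s"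
  shows "\<bar>\<Sum>r\<in>R. (\<Prod>T\<in>Pow {1..s}. coef n k (r T)) * step_charfun s (\<theta> r) ^ (2 * n)\<bar> \<le> off_peak_bound n s \<delta>"
proof -
  let ?E = "Pow {1..s} \<rightarrow>\<^sub>E {-int n..int n}"
  let ?c = "1 - (1 - cos \<delta>) / 2 ^ s"
  have "finite ?E" by (auto intro!: finite_PiE)
  then have "card R \<le> card ?E" using assms(3) by (rule card_mono)
  also have "card ?E = (2 * n + 1) ^ (2 ^ s)"
    by (simp add: card_PiE card_Pow nat_add_distrib nat_mult_distrib Suc_eq_plus1)
  finally have "real (card R) \<le> real (2 * n + 1) ^ (2 ^ s)"
    by (metis of_nat_le_iff of_nat_power)
  have "\<bar>\<Sum>r\<in>R. (\<Prod>T\<in>Pow {1..s}. coef n k (r T)) * step_charfun s (\<theta> r) ^ (2 * n)\<bar>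
      \<le> (\<Sum>r\<in>R. 2 ^ (2 ^ s) * ?c ^ (2 * n))"
    by (rule order.trans[OF sum_abs]) (intro sum_mono summand_le assms)
  also have "\<dots> = real (card R) * (2 ^ (2 ^ s) * ?c ^ (2 * n))" by simp
  also have "\<dots> \<le> real (2 * n + 1) ^ (2 ^ s) * (2 ^ (2 ^ s) * ?c ^ (2 * n))"
    using \<open>real (card R) \<le> _\<close> by (intro mult_right_mono) (auto simp: power_mult)
  also have "\<dots> = off_peak_bound n s \<delta>"
    by (simp only: off_peak_bound_def power_mult_distrib mult_ac)
  finally show ?thesis .
qed

lemma off_peak_bound_nonneg: "0 \<le> off_peak_bound n s \<delta>"
  by (simp add: off_peak_bound_def power_mult)

text \<open>By \<open>step_charfun_peak\<close>, a value of \<open>step_charfun\<close> above the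
  threshold forces both \<open>peak k s j\<close> and all offsets into the window. So without a peak
  everything is tail, and at a peak the window sum is \<open>main_term\<close>.\<close>

lemma inner_sum_approx:
  assumes "1 \<le> k" "1 \<le> n" "s \<le> k" "0 \<le> \<delta>" "\<delta> < pi / 2 ^ k"
  shows "\<bar>inner_sum n k s j - (if peak k s j then main_term n k s \<delta> else 0)\<bar> \<le> off_peak_bound n s \<delta>"
proof -
  let ?E = "Pow {1..s} \<rightarrow>\<^sub>E {-int n..int n}"
  let ?W = "Pow {1..s} \<rightarrow>\<^sub>E window n k \<delta>"
  let ?c = "1 - (1 - cos \<delta>) / 2 ^ s"
  let ?\<theta> = "\<lambda>r T. freq n k (j T) (r T)"
  let ?f = "\<lambda>r. (\<Prod>T\<in>Pow {1..s}. coef n k (r T)) * step_charfun s (?\<theta> r) ^ (2 * n)"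
  have large: "(\<forall>T. T \<subseteq> {1..s} \<longrightarrow> \<bar>small_freq n k (r T)\<bar> \<le> \<delta>) \<and> peak k s j"
    if "r \<in> ?E" "\<bar>step_charfun s (?\<theta> r)\<bar> > ?c" for r
  proof -
    have "\<bar>small_freq n k (r T)\<bar> < pi / 2 ^ k" if "T \<subseteq> {1..s}" for T
      using \<open>r \<in> ?E\<close> that by (intro abs_small_freq_less) (auto simp: PiE_iff)
    then show ?thesis
      using step_charfun_peak[of k s \<delta> "\<lambda>T. small_freq n k (r T)" "\<lambda>T. int (j T)"] assms that(2)
      by (simp add: freq_eq peak_def)
  qed
  show ?thesis
  proof (cases "peak k s j")
    case False
    then have "\<bar>step_charfun s (?\<theta> r)\<bar> \<le> ?c" if "r \<in> ?E" for r
      using large[OF that] False by (meson not_le)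
    then show ?thesis
      using False sum_summands_le[OF assms(1,2) order.refl, of s ?\<theta> \<delta>] by (simp add: inner_sum_def)
  next
    case True
    then obtain \<sigma> where \<sigma>: "\<bar>\<sigma>\<bar> = 1"
      "\<And>u. step_charfun s (\<lambda>T. 2 * pi * real (j T) / 2 ^ k + u T) = \<sigma> * step_charfun s u"
      unfolding peak_def by auto
    have "\<sigma>\<^sup>2 = 1" using \<sigma>(1) by (metis power2_abs power_one)
    then have "\<sigma> ^ (2 * n) = 1" by (simp add: power_mult)
    then have main: "main_term n k s \<delta> = (\<Sum>r\<in>?W. ?f r)"
      by (simp add: main_term_def freq_eq \<sigma>(2) power_mult_distrib)
    have sub: "?W \<subseteq> ?E" by (auto simp: window_def)
    have fin: "finite ?E" by (auto intro!: finite_PiE)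
    have "inner_sum n k s j - main_term n k s \<delta> = (\<Sum>r\<in>?E - ?W. ?f r)"
      unfolding main inner_sum_def using sum.subset_diff[OF sub fin, of ?f] by simp
    moreover have "\<bar>step_charfun s (?\<theta> r)\<bar> \<le> ?c" if r: "r \<in> ?E - ?W" for r
    proof (rule ccontr)
      assume "\<not> ?thesis"
      then have "r \<in> ?W"
        using large[of r] r by (auto simp: PiE_iff window_def)
      with r show False by simp
    qed
    ultimately show ?thesis
      using True sum_summands_le[OF assms(1,2), of "?E - ?W" s ?\<theta> \<delta>] by simp
  qed
qed

text \<open>\<open>M\<close> is the number of peaks. The zero family is one of them, and the
  resulting bound 1 \<le> M lets the main term be recovered from the whole sum when s = 0.\<close>

lemma sum_inner_sum_approx:
  assumes "1 \<le> k" "1 \<le> n" "s \<le> k" "0 \<le> \<delta>" "\<delta> < pi / 2 ^ k"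
  obtains M where "1 \<le> M" "M \<le> (2 ^ k) ^ (2 ^ s)"
    "\<bar>(\<Sum>j\<in>Pow {1..s} \<rightarrow>\<^sub>E {..<2 ^ k}. inner_sum n k s j) - M * main_term n k s \<delta>\<bar>
      \<le> (2 ^ k) ^ (2 ^ s) * off_peak_bound n s \<delta>"
proof -
  let ?J = "Pow {1..s} \<rightarrow>\<^sub>E {..<2 ^ k :: nat}"
  define G where "G = {j \<in> ?J. peak k s j}"
  define M where "M = real (card G)"
  have fin: "finite ?J" by (auto intro!: finite_PiE)
  have card: "real (card ?J) = (2 ^ k) ^ (2 ^ s)"
    by (simp add: card_PiE card_Pow)
  have "(\<lambda>T\<in>Pow {1..s}. 0) \<in> G"
    unfolding peak_def G_def by (auto intro!: exI[of _ 1] step_charfun_cong)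
  moreover have "finite G" using fin by (simp add: G_def)
  ultimately have "card G \<noteq> 0" by auto
  then have "1 \<le> M" by (simp add: M_def)
  moreover have "M \<le> (2 ^ k) ^ (2 ^ s)"
    unfolding M_def card[symmetric] using fin by (intro of_nat_mono card_mono) (auto simp: G_def)
  moreover have "M * main_term n k s \<delta> = (\<Sum>j\<in>?J. if peak k s j then main_term n k s \<delta> else 0)"
    by (simp add: M_def G_def flip: sum.inter_filter[OF fin])
  then have "\<bar>(\<Sum>j\<in>?J. inner_sum n k s j) - M * main_term n k s \<delta>\<bar> \<le> (\<Sum>j\<in>?J. off_peak_bound n s \<delta>)"
    by (simp only: sum_subtractf[symmetric])
      (intro order.trans[OF sum_abs] sum_mono inner_sum_approx assms)
  ultimately show ?thesis
    using that[of M] by (simp only: sum_constant card)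
qed

section \<open>The main term compared with the case s = 0\<close>

lemma main_term_0: "main_term n k 0 \<delta> = (\<Sum>r\<in>window n k \<delta>. coef n k r * cos (small_freq n k r) ^ (2 * n))"
proof -
  have "main_term n k 0 \<delta> = (\<Sum>r\<in>{{} :: nat set} \<rightarrow>\<^sub>E window n k \<delta>. \<Prod>T\<in>{{}}. coef n k (r T) * cos (small_freq n k (r T)) ^ (2 * n))"
    by (simp add: main_term_def step_charfun_0)
  also have "\<dots> = (\<Prod>T\<in>{{} :: nat set}. \<Sum>r\<in>window n k \<delta>. coef n k r * cos (small_freq n k r) ^ (2 * n))"
    by (rule prod_sum_PiE[symmetric]) auto
  finally show ?thesis by simp
qed

text \<open>With the product of cosines in place of \<open>step_charfun\<close>, the sum factors
  into 2^s one-dimensional sums, each equal to \<open>main_term n k 0 \<delta>\<close>. Both bases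
  are at most 1 in absolute value, so the replacement inside the power 2n costs at most 2n times
  their difference.\<close>

lemma main_term_approx:
  assumes "0 \<le> \<delta>" "\<delta> \<le> 1"
  shows "\<bar>main_term n k s \<delta> - main_term n k 0 \<delta> ^ (2 ^ s)\<bar>
    \<le> (\<Sum>r\<in>window n k \<delta>. \<bar>coef n k r\<bar>) ^ (2 ^ s) * (4 * real n * 16 ^ s * \<delta> ^ 4)"
proof -
  let ?P = "Pow {1..s}"
  let ?W = "?P \<rightarrow>\<^sub>E window n k \<delta>"
  let ?a = "\<lambda>r. step_charfun s (\<lambda>T. small_freq n k (r T))"
  let ?b = "\<lambda>r. \<Prod>T\<in>?P. cos (small_freq n k (r T))"
  have "main_term n k 0 \<delta> ^ (2 ^ s) = (\<Prod>T\<in>?P. \<Sum>r\<in>window n k \<delta>. coef n k r * cos (small_freq n k r) ^ (2 * n))"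
    by (simp add: main_term_0 card_Pow)
  also have "\<dots> = (\<Sum>r\<in>?W. \<Prod>T\<in>?P. coef n k (r T) * cos (small_freq n k (r T)) ^ (2 * n))"
    by (rule prod_sum_PiE) auto
  also have "\<dots> = (\<Sum>r\<in>?W. (\<Prod>T\<in>?P. coef n k (r T)) * ?b r ^ (2 * n))"
    by (simp add: prod.distrib prod_power_distrib)
  finally have diff: "main_term n k s \<delta> - main_term n k 0 \<delta> ^ (2 ^ s)
      = (\<Sum>r\<in>?W. (\<Prod>T\<in>?P. coef n k (r T)) * (?a r ^ (2 * n) - ?b r ^ (2 * n)))"
    by (simp only: main_term_def sum_subtractf[symmetric] right_diff_distrib)
  have "\<bar>main_term n k s \<delta> - main_term n k 0 \<delta> ^ (2 ^ s)\<bar>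
      \<le> (\<Sum>r\<in>?W. (\<Prod>T\<in>?P. \<bar>coef n k (r T)\<bar>) * (4 * real n * 16 ^ s * \<delta> ^ 4))"
    unfolding diff
  proof (intro order.trans[OF sum_abs] sum_mono)
    fix r assume r: "r \<in> ?W"
    have "\<bar>?b r\<bar> \<le> 1"
      unfolding abs_prod by (intro prod_le_1) auto
    then have "\<bar>?a r ^ (2 * n) - ?b r ^ (2 * n)\<bar> \<le> real (2 * n) * \<bar>?a r - ?b r\<bar>"
      using norm_power_diff[of "?a r" "?b r" "2 * n"] abs_step_charfun_le by simp
    also have "\<dots> \<le> real (2 * n) * (2 * 16 ^ s * \<delta> ^ 4)"
      using r assms by (intro mult_left_mono step_charfun_near) (auto simp: PiE_iff window_def)
    finally have "\<bar>?a r ^ (2 * n) - ?b r ^ (2 * n)\<bar> \<le> 4 * real n * 16 ^ s * \<delta> ^ 4"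
      by simp
    then show "\<bar>(\<Prod>T\<in>?P. coef n k (r T)) * (?a r ^ (2 * n) - ?b r ^ (2 * n))\<bar>
        \<le> (\<Prod>T\<in>?P. \<bar>coef n k (r T)\<bar>) * (4 * real n * 16 ^ s * \<delta> ^ 4)"
      unfolding abs_mult abs_prod by (intro mult_left_mono) (auto intro: prod_nonneg)
  qed
  also have "\<dots> = (\<Sum>r\<in>?W. \<Prod>T\<in>?P. \<bar>coef n k (r T)\<bar>) * (4 * real n * 16 ^ s * \<delta> ^ 4)"
    by (rule sum_distrib_right[symmetric])
  also have "(\<Sum>r\<in>?W. \<Prod>T\<in>?P. \<bar>coef n k (r T)\<bar>) = (\<Prod>T\<in>?P. \<Sum>r\<in>window n k \<delta>. \<bar>coef n k r\<bar>)"
    by (rule prod_sum_PiE[symmetric]) auto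
  also have "\<dots> = (\<Sum>r\<in>window n k \<delta>. \<bar>coef n k r\<bar>) ^ (2 ^ s)"
    by (simp add: card_Pow)
  finally show ?thesis .
qed

text \<open>The window holds at most 2M + 1 offsets, each contributing at most 1 / (2^k sqrt n)
  apart from the extra 1 at r = 0. The constant 2 covers this extra 1 and the summand 1 of 2M +
  1.\<close>

lemma sum_window_coef_le:
  assumes "1 \<le> k" "1 \<le> n" "0 \<le> \<delta>"
  shows "(\<Sum>r\<in>window n k \<delta>. \<bar>coef n k r\<bar>) \<le> 2 + 2 * \<delta> * sqrt n"
proof -
  define D where "D = 2 ^ k * real (2 * n + 1)"
  have "D > 0" by (simp add: D_def)
  define M where "M = \<delta> * D / (2 * pi)"
  have "M \<ge> 0" using assms \<open>D > 0\<close> by (simp add: M_def)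
  have "window n k \<delta> \<subseteq> {-\<lfloor>M\<rfloor>..\<lfloor>M\<rfloor>}"
  proof
    fix r assume "r \<in> window n k \<delta>"
    then have "\<bar>2 * pi * real_of_int r / D\<bar> \<le> \<delta>"
      by (simp add: window_def small_freq_def D_def)
    then have "\<bar>real_of_int r\<bar> \<le> M"
      using \<open>D > 0\<close> by (simp add: M_def abs_mult field_simps)
    then have "real_of_int \<bar>r\<bar> \<le> M" by simp
    then have "\<bar>r\<bar> \<le> \<lfloor>M\<rfloor>" by (simp only: le_floor_iff)
    then show "r \<in> {-\<lfloor>M\<rfloor>..\<lfloor>M\<rfloor>}" by auto
  qed
  then have "card (window n k \<delta>) \<le> card {-\<lfloor>M\<rfloor>..\<lfloor>M\<rfloor>}"
    by (intro card_mono) auto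
  also have "real \<dots> \<le> 2 * M + 1"
    using \<open>M \<ge> 0\<close> by simp
  finally have card: "real (card (window n k \<delta>)) \<le> 2 * M + 1" by simp
  have root: "sqrt n \<ge> 1" "sqrt n * sqrt n = n" using assms by auto
  have "(\<Sum>r\<in>window n k \<delta>. \<bar>coef n k r\<bar>)
      \<le> (\<Sum>r\<in>window n k \<delta>. 1 / (2 ^ k * sqrt n) + (if r = 0 then 1 else 0))"
    using abs_coef_le[OF assms(1,2)] by (intro sum_mono)
  also have "\<dots> \<le> card (window n k \<delta>) * (1 / (2 ^ k * sqrt n)) + 1"
    by (simp add: sum.distrib)
  also have "\<dots> \<le> (2 * M + 1) * (1 / (2 ^ k * sqrt n)) + 1"
    using card by (intro add_right_mono mult_right_mono) auto
  also have "\<dots> = 2 * M / (2 ^ k * sqrt n) + 1 / (2 ^ k * sqrt n) + 1"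
    by (simp add: add_divide_distrib)
  also have "1 / (2 ^ k * sqrt n) \<le> 1"
    using mult_mono[of 1 "2 ^ k" 1 "sqrt n"] root by (simp add: divide_le_eq)
  also have "2 * M / (2 ^ k * sqrt n) = \<delta> * (real (2 * n + 1) / (pi * sqrt n))"
    by (simp add: M_def D_def)
  also have "\<dots> \<le> \<delta> * (2 * sqrt n)"
  proof (intro mult_left_mono)
    have "real (2 * n + 1) \<le> 2 * real n * 2" using assms by simp
    also have "\<dots> \<le> 2 * real n * pi" using pi_ge_two by (intro mult_left_mono) auto
    also have "\<dots> = 2 * sqrt n * (pi * sqrt n)" using root by (simp add: mult_ac)
    finally show "real (2 * n + 1) / (pi * sqrt n) \<le> 2 * sqrt n"
      using root by (simp add: divide_le_eq)
  qed (use assms in auto)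
  finally show ?thesis by simp
qed

lemma abs_gowers_average_le:
  assumes "1 \<le> k" "1 \<le> n" "s \<le> k" "0 \<le> \<delta>" "\<delta> \<le> 1" "\<delta> < pi / 2 ^ k"
  shows "\<bar>Re (gowers_average (2 * n) s (slice_difference n k))\<bar>
    \<le> (2 ^ k) ^ (2 ^ s) * (off_peak_bound n s \<delta> + (2 ^ k * off_peak_bound n 0 \<delta>) ^ (2 ^ s)
        + (2 + 2 * \<delta> * sqrt n) ^ (2 ^ s) * (4 * real n * 16 ^ s * \<delta> ^ 4))"
proof -
  have fourier: "gowers_average (2 * n) s (slice_difference n k)
      = of_real (\<Sum>j\<in>Pow {1..s} \<rightarrow>\<^sub>E {..<2 ^ k}. inner_sum n k s j)" for s
    by (simp only: gowers_average_fourier[OF assms(1)] inner_sum_def)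
  \<comment> \<open>For s = 0 the whole sum is the mean of the difference, hence 0. So M times the
    main term is bounded by the tail, and 1 \<le> M.\<close>
  have main_0: "\<bar>main_term n k 0 \<delta>\<bar> \<le> 2 ^ k * off_peak_bound n 0 \<delta>"
  proof -
    obtain M where M: "1 \<le> M" "M \<le> (2 ^ k) ^ (2 ^ 0)"
      "\<bar>(\<Sum>j\<in>Pow {1..0} \<rightarrow>\<^sub>E {..<2 ^ k}. inner_sum n k 0 j) - M * main_term n k 0 \<delta>\<bar>
        \<le> (2 ^ k) ^ (2 ^ 0) * off_peak_bound n 0 \<delta>"
      by (rule sum_inner_sum_approx[OF assms(1,2) le0 assms(4,6)])
    have "(\<Sum>j\<in>Pow {1..0} \<rightarrow>\<^sub>E {..<2 ^ k}. inner_sum n k 0 j) = 0"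
      using gowers_average_0_eq_0[OF assms(1,2)] unfolding fourier by (simp only: of_real_eq_0_iff)
    then have "M * \<bar>main_term n k 0 \<delta>\<bar> \<le> 2 ^ k * off_peak_bound n 0 \<delta>"
      using M by (simp only: diff_0 abs_minus abs_mult) simp
    moreover have "1 * \<bar>main_term n k 0 \<delta>\<bar> \<le> M * \<bar>main_term n k 0 \<delta>\<bar>"
      using M by (intro mult_right_mono) auto
    ultimately show ?thesis by linarith
  qed
  define X where "X = (2 + 2 * \<delta> * sqrt n) ^ (2 ^ s) * (4 * real n * 16 ^ s * \<delta> ^ 4)"
  have "\<bar>main_term n k s \<delta> - main_term n k 0 \<delta> ^ (2 ^ s)\<bar>
      \<le> (\<Sum>r\<in>window n k \<delta>. \<bar>coef n k r\<bar>) ^ (2 ^ s) * (4 * real n * 16 ^ s * \<delta> ^ 4)"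
    by (rule main_term_approx[OF assms(4,5)])
  also have "\<dots> \<le> X"
    unfolding X_def using sum_window_coef_le[OF assms(1,2,4)] assms
    by (intro mult_right_mono power_mono) (auto intro: sum_nonneg)
  finally have "\<bar>main_term n k s \<delta> - main_term n k 0 \<delta> ^ (2 ^ s)\<bar> \<le> X" .
  moreover have "\<bar>main_term n k 0 \<delta> ^ (2 ^ s)\<bar> \<le> (2 ^ k * off_peak_bound n 0 \<delta>) ^ (2 ^ s)"
    unfolding power_abs using main_0 by (intro power_mono) auto
  ultimately have main: "\<bar>main_term n k s \<delta>\<bar> \<le> (2 ^ k * off_peak_bound n 0 \<delta>) ^ (2 ^ s) + X"
    by linarith
  obtain M where M: "1 \<le> M" "M \<le> (2 ^ k) ^ (2 ^ s)"
    "\<bar>(\<Sum>j\<in>Pow {1..s} \<rightarrow>\<^sub>E {..<2 ^ k}. inner_sum n k s j) - M * main_term n k s \<delta>\<bar>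
      \<le> (2 ^ k) ^ (2 ^ s) * off_peak_bound n s \<delta>"
    by (rule sum_inner_sum_approx[OF assms(1-4,6)])
  have "\<bar>M * main_term n k s \<delta>\<bar> \<le> (2 ^ k) ^ (2 ^ s) * ((2 ^ k * off_peak_bound n 0 \<delta>) ^ (2 ^ s) + X)"
    unfolding abs_mult using M main by (intro mult_mono) auto
  then have "\<bar>\<Sum>j\<in>Pow {1..s} \<rightarrow>\<^sub>E {..<2 ^ k}. inner_sum n k s j\<bar>
      \<le> (2 ^ k) ^ (2 ^ s) * off_peak_bound n s \<delta> + (2 ^ k) ^ (2 ^ s) * ((2 ^ k * off_peak_bound n 0 \<delta>) ^ (2 ^ s) + X)"
    using M(3) by linarith
  then show ?thesis
    unfolding fourier X_def[symmetric] by (simp add: distrib_left add.assoc)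
qed

section \<open>Windows of radius ln n / sqrt n and the final estimate\<close>

lemma off_peak_bound_le:
  assumes "6 \<le> n" "\<delta> = ln n / sqrt n" "\<delta> \<le> 1" "2 ^ (s + 1) * (2 * 2 ^ s + 1) \<le> ln n"
  shows "off_peak_bound n s \<delta> \<le> 1 / n"
proof -
  define l where "l = ln (real n)"
  have l: "l > 0" using assms(1) by (simp add: l_def)
  have "\<delta> ^ 4 \<le> \<delta>\<^sup>2"
    using assms(3) l by (intro power_decreasing) (auto simp: assms(2) l_def)
  then have "1 - cos \<delta> \<ge> \<delta>\<^sup>2 / 4"
    using cos_taylor2[of \<delta>] by linarith
  moreover have "\<delta>\<^sup>2 = l\<^sup>2 / n"
    by (simp add: assms(2) l_def power_divide)
  ultimately have cos: "(1 - cos \<delta>) / 2 ^ s \<ge> l\<^sup>2 / (2 ^ s * 4 * n)"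
    by (simp add: field_simps)
  have "0 \<le> 1 - (1 - cos \<delta>) / 2 ^ s"
  proof -
    have "0 \<le> \<delta>" using l by (simp add: assms(2) l_def)
    then have "0 \<le> cos \<delta>" using assms(3) pi_ge_two by (intro cos_ge_zero) linarith+
    then have "(1 - cos \<delta>) / 2 ^ s \<le> 1 / 1" by (intro frac_le) auto
    then show ?thesis by simp
  qed
  moreover have "1 - (1 - cos \<delta>) / 2 ^ s \<le> exp (- (l\<^sup>2 / (2 ^ s * 4 * n)))"
    using cos exp_ge_add_one_self[of "- (l\<^sup>2 / (2 ^ s * 4 * n))"] by linarith
  ultimately have "(1 - (1 - cos \<delta>) / 2 ^ s) ^ (2 * n) \<le> exp (- (l\<^sup>2 / (2 ^ s * 4 * n))) ^ (2 * n)"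
    by (intro power_mono)
  also have "\<dots> = exp (- (l\<^sup>2 / 2 ^ (s + 1)))"
    using assms(1) by (simp add: power_add flip: exp_of_nat_mult)
  finally have decay: "(1 - (1 - cos \<delta>) / 2 ^ s) ^ (2 * n) \<le> exp (- (l\<^sup>2 / 2 ^ (s + 1)))" .
  \<comment> \<open>Thanks to 6 \<le> n, the number of families times the coefficient bounds is at
    most n^(2 * 2^s).\<close>
  have "2 * real (2 * n + 1) \<le> 6 * real n" using assms(1) by simp
  also have "\<dots> \<le> (real n)\<^sup>2"
    unfolding power2_eq_square using assms(1) by (intro mult_right_mono) auto
  also have "\<dots> = exp (2 * l)"
    unfolding exp_double using assms(1) by (simp add: l_def)
  finally have "(2 * real (2 * n + 1)) ^ (2 ^ s) \<le> exp (2 * l) ^ (2 ^ s)"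
    by (intro power_mono) auto
  also have "\<dots> = exp (2 * 2 ^ s * l)"
    using exp_of_nat_mult[of "2 ^ s" "2 * l"] by (simp add: mult_ac)
  finally have "off_peak_bound n s \<delta> \<le> exp (2 * 2 ^ s * l) * exp (- (l\<^sup>2 / 2 ^ (s + 1)))"
    unfolding off_peak_bound_def using decay by (intro mult_mono) (auto simp: power_mult)
  also have "\<dots> = exp (2 * 2 ^ s * l - l\<^sup>2 / 2 ^ (s + 1))"
    by (simp flip: exp_add)
  \<comment> \<open>The decay exp (- l^2 / 2^(s + 1)) beats this power of n with a factor 1 / n to
    spare, by the assumed lower bound on ln n.\<close>
  also have "\<dots> \<le> exp (- l)"
  proof -
    have "2 ^ (s + 1) * (2 * 2 ^ s + 1) * l \<le> l * l"
      using assms(4) l by (intro mult_right_mono) (auto simp: l_def)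
    then have "(2 * 2 ^ s + 1) * l \<le> l\<^sup>2 / 2 ^ (s + 1)"
      by (simp add: field_simps power2_eq_square)
    then show ?thesis by (simp add: algebra_simps)
  qed
  also have "\<dots> = 1 / n"
    using assms(1) by (simp add: l_def exp_minus inverse_eq_divide)
  finally show ?thesis .
qed

text \<open>Take \<delta> = l / sqrt n with l = ln n. The tails are O(1 / n), and the replacement
  error is a constant times l^(2^s) * l^4 / n: the first power comes from the coefficient sums, and
  n * \<delta>^4 = l^4 / n. One more logarithm absorbs the constants, whence the exponent 2^s +
  5.\<close>

lemma abs_gowers_average_asymp:
  assumes "1 \<le> k" "s \<le> k"
  shows "\<forall>\<^sub>F n in sequentially. \<bar>Re (gowers_average (2 * n) s (slice_difference n k))\<bar>
    \<le> ln (real n) ^ (2 ^ s + 5) / real n"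
proof -
  let ?S = "2 ^ s :: nat"
  define K :: real where "K = (2 ^ k) ^ ?S"
  define B where "B = K * (1 + K + 3 ^ ?S * (4 * 16 ^ s))"
  have "\<forall>\<^sub>F n in sequentially. ln (real n) / sqrt n < min 1 (pi / 2 ^ k)"
  proof -
    have "(\<lambda>n. ln (real n) / sqrt n) \<longlonglongrightarrow> 0" by real_asymp
    then show ?thesis by (rule order_tendstoD) simp
  qed
  moreover have "\<forall>\<^sub>F n in sequentially. max (max 2 B) (2 ^ (s + 1) * (2 * 2 ^ s + 1)) \<le> ln (real n)"
  proof -
    have "filterlim (\<lambda>n. ln (real n)) at_top sequentially" by real_asymp
    then show ?thesis by (simp only: filterlim_at_top)
  qed
  ultimately show ?thesis
    using eventually_ge_at_top[of 6]
  proof eventually_elim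
    case (elim n)
    define l where "l = ln (real n)"
    define \<delta> where "\<delta> = l / sqrt n"
    have l: "2 \<le> l" "B \<le> l" "2 ^ (s + 1) * (2 * 2 ^ s + 1) \<le> l"
      using elim by (auto simp: l_def)
    have \<delta>: "0 \<le> \<delta>" "\<delta> \<le> 1" "\<delta> < pi / 2 ^ k"
      using elim l by (auto simp: \<delta>_def l_def)
    have n: "1 \<le> n" "0 < real n" using elim by auto
    have tail_s: "off_peak_bound n s \<delta> \<le> 1 / n"
      using elim l \<delta> by (intro off_peak_bound_le) (auto simp: \<delta>_def l_def)
    \<comment> \<open>At s = 0, \<open>off_peak_bound_le\<close> asks for 6 \<le> ln n, which the
      threshold for s implies.\<close>
    have "(3::real) * 2 \<le> 2 ^ (s + 1) * (2 * 2 ^ s + 1)"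
    proof -
      have "(2::real) * 3 \<le> 2 ^ (s + 1) * (2 * 2 ^ s + 1)"
        by (intro mult_mono) (auto simp: power_add)
      then show ?thesis by simp
    qed
    then have tail_0: "off_peak_bound n 0 \<delta> \<le> 1 / n"
      using elim l \<delta> by (intro off_peak_bound_le) (auto simp: \<delta>_def l_def)
    have "(2 ^ k * off_peak_bound n 0 \<delta>) ^ ?S \<le> (2 ^ k * (1 / n)) ^ ?S"
      using tail_0 off_peak_bound_nonneg by (intro power_mono mult_left_mono) auto
    also have "\<dots> = K * (1 / n) ^ ?S" by (simp only: K_def power_mult_distrib)
    also have "\<dots> \<le> K * (1 / n) ^ 1"
      using n by (intro mult_left_mono power_decreasing) (auto simp: K_def)
    finally have tails: "(2 ^ k * off_peak_bound n 0 \<delta>) ^ ?S \<le> K * (1 / n)" by simp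
    have "\<delta> * sqrt n = l" using n by (simp add: \<delta>_def)
    then have "2 + 2 * \<delta> * sqrt n \<le> 3 * l" "0 \<le> 2 + 2 * \<delta> * sqrt n" using l by auto
    then have "(2 + 2 * \<delta> * sqrt n) ^ ?S \<le> (3 * l) ^ ?S" by (intro power_mono)
    moreover have "4 * real n * 16 ^ s * \<delta> ^ 4 = 4 * 16 ^ s * (l ^ 4 / n)"
    proof -
      have "(sqrt n) ^ 4 = (real n)\<^sup>2"
        using n power_mult[of "sqrt n" 2 2] by simp
      then show ?thesis using n by (simp add: \<delta>_def power_divide power2_eq_square)
    qed
    ultimately have "(2 + 2 * \<delta> * sqrt n) ^ ?S * (4 * real n * 16 ^ s * \<delta> ^ 4) \<le> (3 * l) ^ ?S * (4 * 16 ^ s * (l ^ 4 / n))"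
      using l by (simp only:, intro mult_right_mono) auto
    also have "\<dots> = 3 ^ ?S * (4 * 16 ^ s) * (l ^ (?S + 4) / n)"
      by (simp add: power_mult_distrib power_add mult_ac)
    finally have near: "(2 + 2 * \<delta> * sqrt n) ^ ?S * (4 * real n * 16 ^ s * \<delta> ^ 4) \<le> 3 ^ ?S * (4 * 16 ^ s) * (l ^ (?S + 4) / n)" .
    have "1 \<le> l ^ (?S + 4)" using l by (intro one_le_power) auto
    then have one: "1 / n \<le> l ^ (?S + 4) / n" by (intro divide_right_mono) auto
    have "\<bar>Re (gowers_average (2 * n) s (slice_difference n k))\<bar>
        \<le> K * (off_peak_bound n s \<delta> + (2 ^ k * off_peak_bound n 0 \<delta>) ^ ?S + (2 + 2 * \<delta> * sqrt n) ^ ?S * (4 * real n * 16 ^ s * \<delta> ^ 4))"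
      unfolding K_def using abs_gowers_average_le[OF assms(1) n(1) assms(2) \<delta>] .
    also have "\<dots> \<le> K * (1 * (l ^ (?S + 4) / n) + K * (l ^ (?S + 4) / n) + 3 ^ ?S * (4 * 16 ^ s) * (l ^ (?S + 4) / n))"
    proof (intro mult_left_mono add_mono near)
      show "off_peak_bound n s \<delta> \<le> 1 * (l ^ (?S + 4) / n)" using tail_s one by simp
      show "(2 ^ k * off_peak_bound n 0 \<delta>) ^ ?S \<le> K * (l ^ (?S + 4) / n)"
        using tails mult_left_mono[OF one, of K] by (simp add: K_def)
    qed (simp add: K_def)
    also have "\<dots> = B * (l ^ (?S + 4) / n)"
      unfolding B_def by (simp only: distrib_right mult.assoc)
    also have "\<dots> \<le> l * (l ^ (?S + 4) / n)"
      using l by (intro mult_right_mono) auto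
    also have "\<dots> = l ^ (?S + 5) / n"
      by (simp only: times_divide_eq_right power_Suc[symmetric]) (simp add: add.commute)
    finally show ?case by (simp add: l_def)
  qed
qed

text \<open>
  Since \<^const>\<open>root\<close> is odd, an even power of an even root is the absolute value: the sign of the
  average does not matter.
\<close>

lemma gowers_norm_power:
  assumes "1 \<le> s"
  shows "gowers_norm m s F ^ (2 ^ s) = \<bar>Re (gowers_average m s F)\<bar>"
proof -
  have "even (2 ^ s :: nat)" using assms by simp
  then have "gowers_norm m s F ^ (2 ^ s) = \<bar>gowers_norm m s F\<bar> ^ (2 ^ s)"
    by (simp add: power_even_abs)
  also have "\<dots> = root (2 ^ s) \<bar>Re (gowers_average m s F)\<bar> ^ (2 ^ s)"
    by (simp add: gowers_norm_def real_root_abs)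
  also have "\<dots> = \<bar>Re (gowers_average m s F)\<bar>"
    by (intro real_root_pow_pos2) auto
  finally show ?thesis .
qed

theorem theorem3p4:
  fixes k :: nat
  assumes "1 \<le> k"
  shows "\<exists>(C :: nat \<Rightarrow> real) (n0 :: nat). \<forall>k'. 1 \<le> k' \<and> k' \<le> k \<longrightarrow> (\<forall>n\<ge>n0.
           gowers_norm (2 * n) k'
             (\<lambda>x. normalized_indicator (2 * n) (middle_slice n) x
                - normalized_indicator (2 * n) (mod_slice n k) x) ^ (2 ^ k')
           \<le> ln (real n) powr C k' / real n)"
proof -
  have "\<forall>\<^sub>F n in sequentially. \<forall>s\<in>{1..k}. \<bar>Re (gowers_average (2 * n) s (slice_difference n k))\<bar>
      \<le> ln (real n) ^ (2 ^ s + 5) / real n"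
    using abs_gowers_average_asymp[OF assms] by (intro eventually_ball_finite) auto
  then have "\<forall>\<^sub>F n in sequentially. 2 \<le> n \<and> (\<forall>s\<in>{1..k}. \<bar>Re (gowers_average (2 * n) s (slice_difference n k))\<bar>
      \<le> ln (real n) ^ (2 ^ s + 5) / real n)"
    using eventually_ge_at_top[of 2] by eventually_elim simp
  \<comment> \<open>The orders form the finite set {1..k}, so a single \<open>n0\<close> serves all
    of them.\<close>
  then obtain n0 where n0: "\<And>n s. n \<ge> n0 \<Longrightarrow> s \<in> {1..k} \<Longrightarrow>
      \<bar>Re (gowers_average (2 * n) s (slice_difference n k))\<bar> \<le> ln (real n) ^ (2 ^ s + 5) / real n"
      "\<And>n. n \<ge> n0 \<Longrightarrow> 2 \<le> n"
    unfolding eventually_sequentially by blast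
  show ?thesis
  proof (intro exI allI impI)
    fix s n assume s: "1 \<le> s \<and> s \<le> k" and n: "n0 \<le> n"
    \<comment> \<open>Passing from the power to \<open>powr\<close> requires a positive base, hence
      the condition 2 \<le> n built into \<open>n0\<close>.\<close>
    have "0 < ln (real n)" using n0(2)[OF n] by simp
    then have "ln (real n) powr real (2 ^ s + 5) = ln (real n) ^ (2 ^ s + 5)"
      by (rule powr_realpow)
    then show "gowers_norm (2 * n) s
        (\<lambda>x. normalized_indicator (2 * n) (middle_slice n) x
           - normalized_indicator (2 * n) (mod_slice n k) x) ^ (2 ^ s)
      \<le> ln (real n) powr real (2 ^ s + 5) / real n"
      using n0(1)[OF n, of s] s by (simp only: gowers_norm_power slice_difference_def[symmetric, abs_def]) simp
  qed
qed

end
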